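(* Let $\mathcal X=[0,1]$, let $0<c_0<1<c_1$ and $c_2$ be constants, and let $\mathcal M^*$ be the set of all distributions $P^*$ under which $X_1,X_2,\ldots$ are i.i.d. with a density $p^*$ on $[0,1]$ satisfying $c_0\le p^*(x)\le c_1$ and $|\frac{d}{dx}p^*(x)|\le c_2$ for all $x\in[0,1]$. For $k\in\mathbb Z^+$ let $\bar p_k$ be the equal-width histogram estimator with $k$ bins, $$\bar p_k(X_{n+1}\mid x^n)=\frac{n_{X_{n+1}}(x^n)+1}{n+k}\cdot k,$$ where $n_{X_{n+1}}(x^n)$ is the number of outcomes among $x_1,\ldots,x_n$ that fall into the same bin as $X_{n+1}$, the bins being $[0,1/k],(1/k,2/k],\ldots,((k-1)/k,1]$. Let $P_{\rm sw}$ be the switch distribution relative to $\bar p_1,\bar p_2,\ldots$ with a prior of the product form $\pi(\mathbf s)=\pi_{\rm M}(m)\pi_{\rm K}(k_1)\prod_{i=2}^m\pi_{\rm T}(t_i\mid t_i>t_{i-1})\pi_{\rm K}(k_i)$ satisfying $-\log\pi_{\rm M}(m)=O(m)$, $-\log\pi_{\rm K}(k)=O(\log k)$ and $-\log\pi_{\rm T}(t)=O(\log t)$. Then $$\sup_{P^*\in\mathcal M^*}\sum_{i=1}^n r_i(P^*,P_{\rm sw})\ \preceq\ n^{1/3},$$ i.e. there are $C>0$ and $n_0$ such that the left-hand side is at most $C\,n^{1/3}$ for all $n\ge n_0$.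
   Context: Logarithms are base 2; densities on $[0,1]$ are relative to Lebesgue measure; $\mathbb N=\{0,1,\dots\}$, $\mathbb Z^+=\{1,2,\dots\}$; $x^n=(x_1,\ldots,x_n)$. Switch distribution: $\mathbb{S}=\{((t_1,k_1),\ldots,(t_m,k_m))\in(\mathbb N\times\mathbb Z^+)^m\mid m\in\mathbb Z^+,\ 0=t_1<\cdots<t_m\}$. For $\mathbf s\in\mathbb S$, $q_{\mathbf s}$ is the prediction strategy that predicts $X_{n+1}$ given $x^n$ by $\bar p_{k_i}(X_{n+1}\mid x^n)$, where $i$ is the unique index with $t_i\le n$ and ($i=m$ or $t_{i+1}>n$); $q_{\mathbf s}(x^n)=\prod_{j=1}^nq_{\mathbf s}(x_j\mid x^{j-1})$. The switch distribution with prior $\pi$ (a mass function on $\mathbb S$) is given by $p_{\rm sw}(x^n)=\sum_{\mathbf s\in\mathbb S}q_{\mathbf s}(x^n)\pi(\mathbf s)$, with conditionals $p_{\rm sw}(x_{n+1}\mid x^n)=p_{\rm sw}(x^{n+1})/p_{\rm sw}(x^n)$. In the product form, $\pi_{\rm M},\pi_{\rm K},\pi_{\rm T}$ are probability mass functions on $\mathbb Z^+$ with full support, and $\pi_{\rm T}(t\mid t>t')=\pi_{\rm T}(t)/\sum_{u>t'}\pi_{\rm T}(u)$ for $t>t'$. The $O(\cdot)$ conditions on the prior are as the argument tends to infinity. Risk: $r_n(P^*,\bar P)=E_{X^{n-1}\sim P^*}\big[D\big(P^*(X_n=\cdot\mid X^{n-1})\,\|\,\bar P(X_n=\cdot\mid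 X^{n-1})\big)\big]$, where $D(P\|Q)=E_P[\log(p(Y)/q(Y))]$ is the Kullback–Leibler divergence. *)

theory Defs
  imports "HOL-Probability.Probability" "HOL-Library.Landau_Symbols"
begin

text \<open>Sample sequences are functions \<^typ>\<open>nat \<Rightarrow> real\<close> whose coordinate \<open>i\<close> is the outcome
  \<open>X\<^bsub>i+1\<^esub>\<close>; finite samples \<open>x\<^sup>n\<close> seen by a prediction strategy are lists.
  A prediction strategy maps the past and a candidate next outcome to the predictive density.\<close>

type_synonym strategy = "real list \<Rightarrow> real \<Rightarrow> real"

definition unit_lborel :: "real measure" where
  "unit_lborel = restrict_space lborel {0..1}"

definition seq_space :: "nat set \<Rightarrow> (nat \<Rightarrow> real) measure" where
  "seq_space I = PiM I (\<lambda>_. unit_lborel)"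


subsection \<open>Histogram estimators\<close>

text \<open>The bins are indexed by \<open>j \<in> {1..k}\<close>; only the first one is closed on the left.\<close>

definition hist_bin :: "nat \<Rightarrow> nat \<Rightarrow> real set" where
  "hist_bin k j = (if j = 1 then {0..1 / real k} else {(real j - 1) / real k<..real j / real k})"

definition same_bin :: "nat \<Rightarrow> real \<Rightarrow> real \<Rightarrow> bool" where
  "same_bin k x y \<longleftrightarrow> (\<exists>j\<in>{1..k}. x \<in> hist_bin k j \<and> y \<in> hist_bin k j)"

definition histogram :: "nat \<Rightarrow> strategy" where
  "histogram k xs y =
     (real (length (filter (\<lambda>x. same_bin k x y) xs)) + 1) / real (length xs + k) * real k"


subsection \<open>The switch distribution\<close>

text \<open>List positions are counted from 0, so \<open>(t\<^sub>i, k\<^sub>i)\<close> is \<open>s ! (i - 1)\<close>.\<close>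

definition switch_params :: "(nat \<times> nat) list set" where
  "switch_params = {s. s \<noteq> [] \<and> fst (s ! 0) = 0 \<and> sorted_wrt (<) (map fst s)
                      \<and> (\<forall>(t, k)\<in>set s. k \<ge> 1)}"

definition active_index :: "(nat \<times> nat) list \<Rightarrow> nat \<Rightarrow> nat" where
  "active_index s n = (THE i. i < length s \<and> fst (s ! i) \<le> n
                            \<and> (Suc i = length s \<or> fst (s ! Suc i) > n))"

definition switch_strategy :: "(nat \<Rightarrow> strategy) \<Rightarrow> (nat \<times> nat) list \<Rightarrow> strategy" where
  "switch_strategy p s xs y = p (snd (s ! active_index s (length xs))) xs y"

definition joint_density :: "strategy \<Rightarrow> real list \<Rightarrow> real" where
  "joint_density q xs = (\<Prod>j<length xs. q (take j xs) (xs ! j))"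

definition switch_density ::
    "(nat \<Rightarrow> strategy) \<Rightarrow> ((nat \<times> nat) list \<Rightarrow> real) \<Rightarrow> real list \<Rightarrow> real" where
  "switch_density p \<pi> xs =
     (\<Sum>\<^sub>\<infinity>s\<in>switch_params. joint_density (switch_strategy p s) xs * \<pi> s)"

definition switch_distribution ::
    "(nat \<Rightarrow> strategy) \<Rightarrow> ((nat \<times> nat) list \<Rightarrow> real) \<Rightarrow> strategy" where
  "switch_distribution p \<pi> xs y = switch_density p \<pi> (xs @ [y]) / switch_density p \<pi> xs"

definition pmf_after :: "nat pmf \<Rightarrow> nat \<Rightarrow> nat \<Rightarrow> real" where
  "pmf_after \<pi>T t' t = pmf \<pi>T t / measure_pmf.prob \<pi>T {t'<..}"

definition product_prior ::
    "nat pmf \<Rightarrow> nat pmf \<Rightarrow> nat pmf \<Rightarrow> (nat \<times> nat) list \<Rightarrow> real" where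
  "product_prior \<pi>M \<pi>K \<pi>T s =
     pmf \<pi>M (length s) * pmf \<pi>K (snd (s ! 0)) *
     (\<Prod>i\<in>{1..<length s}. pmf_after \<pi>T (fst (s ! (i - 1))) (fst (s ! i)) * pmf \<pi>K (snd (s ! i)))"


subsection \<open>Risk\<close>

text \<open>\<open>K\<close> is a regular conditional distribution, under \<open>P\<close>, of coordinate \<open>n\<close> given
  coordinates \<open>0, \<dots>, n - 1\<close>.\<close>

definition is_cond_distr ::
    "(nat \<Rightarrow> real) measure \<Rightarrow> nat \<Rightarrow> ((nat \<Rightarrow> real) \<Rightarrow> real measure) \<Rightarrow> bool" where
  "is_cond_distr P n K \<longleftrightarrow>
     K \<in> seq_space {..<n} \<rightarrow>\<^sub>M prob_algebra unit_lborel \<and>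
     (\<forall>B\<in>sets (seq_space {..<n}). \<forall>A\<in>sets unit_lborel.
        emeasure P {\<omega>\<in>space P. restrict \<omega> {..<n} \<in> B \<and> \<omega> n \<in> A} =
        (\<integral>\<^sup>+\<omega>. emeasure (K (restrict \<omega> {..<n})) A * indicator B (restrict \<omega> {..<n}) \<partial>P))"

text \<open>Regular conditional distributions are almost surely unique, so the choice of a version
  does not affect the risk below.\<close>

definition cond_distr ::
    "(nat \<Rightarrow> real) measure \<Rightarrow> nat \<Rightarrow> (nat \<Rightarrow> real) \<Rightarrow> real measure" where
  "cond_distr P n = (SOME K. is_cond_distr P n K)"

text \<open>The divergence \<open>D(P \<parallel> Q)\<close> in bits with its value \<open>\<infinity>\<close>. The library constant
  takes its arguments in the order \<open>Q\<close>, \<open>P\<close>, and is meaningful only in the first case.\<close>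

definition KL_div :: "'a measure \<Rightarrow> 'a measure \<Rightarrow> ennreal" where
  "KL_div P Q = (if absolutely_continuous Q P \<and> integrable P (entropy_density 2 Q P)
                 then ennreal (KL_divergence 2 Q P) else \<infinity>)"

text \<open>For \<open>n \<ge> 1\<close>: the outcome \<open>X\<^sub>n\<close> is coordinate \<open>n - 1\<close>, predicted from \<open>n - 1\<close> past outcomes.\<close>

definition risk :: "nat \<Rightarrow> (nat \<Rightarrow> real) measure \<Rightarrow> strategy \<Rightarrow> ennreal" where
  "risk n P q =
     (\<integral>\<^sup>+\<omega>. KL_div (cond_distr P (n - 1) (restrict \<omega> {..<n - 1}))
                  (density unit_lborel (\<lambda>y. ennreal (q (map \<omega> [0..<n - 1]) y))) \<partial>P)"


subsection \<open>The model\<close>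

definition smooth_iid :: "real \<Rightarrow> real \<Rightarrow> real \<Rightarrow> (nat \<Rightarrow> real) measure set" where
  "smooth_iid c0 c1 c2 = {P.
     prob_space P \<and> sets P = sets (seq_space UNIV) \<and>
     prob_space.indep_vars P (\<lambda>_. unit_lborel) (\<lambda>i \<omega>. \<omega> i) UNIV \<and>
     (\<exists>f f'. (\<forall>i. distributed P unit_lborel (\<lambda>\<omega>. \<omega> i) (\<lambda>x. ennreal (f x))) \<and>
        (\<forall>x\<in>{0..1}. c0 \<le> f x \<and> f x \<le> c1 \<and>
           (f has_real_derivative f' x) (at x within {0..1}) \<and> \<bar>f' x\<bar> \<le> c2))}"

end

theory Submission
  imports Defs
begin

text \<open>
  Cumulative risk is expected cumulative log-loss regret: by the chain rule the risks of a strategy add up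
  to the expectation of \<open>log (p\<^sup>*(x\<^sup>n) / q(x\<^sup>n))\<close>. The switch density is a mixture, hence at least
  \<open>\<pi>(s) q\<^sub>s(x\<^sup>n)\<close> for every single switch sequence \<open>s\<close>. So the cumulative risk of the switch distribution
  is at most \<open>- log \<pi>(s)\<close> plus the cumulative risk of \<open>q\<^sub>s\<close> (\<open>sum_redundancy_le\<close>), and one good \<open>s\<close>
  suffices.

  A histogram with \<open>k\<close> bins has risk \<open>O(k / n + 1 / k\<^sup>2)\<close> after \<open>n\<close> outcomes (\<open>redundancy_histogram_le\<close>).
  A fixed number of bins of order \<open>n powr (1/3)\<close> would give a cumulative risk with an additional factor
  \<open>log n\<close>, caused by too many bins early on. The sequence \<open>doubling m\<close> uses \<open>2 ^ i\<close> bins between sample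
  sizes \<open>8 ^ i\<close> and \<open>8 ^ (i + 1)\<close>. Then the number of bins always has the order of the cube root of
  the sample size, the risk at sample size \<open>n\<close> is \<open>O(n powr (-2/3))\<close>, and the sum is \<open>O(n powr (1/3))\<close>.
  There are \<open>O(log n)\<close> switches, each of which costs \<open>O(log n)\<close> bits under the prior, so that
  \<open>- log \<pi>(s)\<close> is \<open>O((log n)\<^sup>2)\<close> and negligible (\<open>neg_log_prior_doubling\<close>).

  The risk of a single histogram prediction \<open>h\<close> is bounded via \<open>ln z \<le> z - 1\<close> by the expectation of
  \<open>p\<^sup>* / h - 1\<close>. For a bin of probability \<open>p\<close> with count \<open>N\<close>, size biasing shows that the expectation of
  \<open>1 / (N + 1)\<close> is at most \<open>1 / ((n + 1) p)\<close>. What remains is the integral of \<open>p\<^sup>*\<^sup>2 / g\<close>, where \<open>g\<close> averages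
  \<open>p\<^sup>*\<close> over bins, and it is \<open>1 + O(1 / k\<^sup>2)\<close> since \<open>p\<^sup>*\<close> is Lipschitz and bounded away from zero.

  Two facts carry the measure theory. The law of an i.i.d. sequence does not change when one coordinate is
  redrawn, which yields the conditional distributions and all iterated integrals. And the predictions of
  histograms, of switching strategies and of their mixtures all lie between \<open>1 / (n + 1)\<close> and \<open>n + 1\<close>
  (\<open>admissible\<close>), so that every logarithmic loss is bounded and every divergence finite.
\<close>

section \<open>The unit interval and its bins\<close>

lemma space_unit_lborel [simp]: "space unit_lborel = {0..1}"
  by (simp add: unit_lborel_def space_restrict_space)

lemma emeasure_unit_lborel:
  assumes "A \<in> sets borel" "A \<subseteq> {0..1}"
  shows "emeasure unit_lborel A = emeasure lborel A"
  using assms unfolding unit_lborel_def by (subst emeasure_restrict_space) auto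

lemma sets_unit_lborel: "A \<in> sets borel \<Longrightarrow> A \<subseteq> {0..1} \<Longrightarrow> A \<in> sets unit_lborel"
  unfolding unit_lborel_def by (subst sets_restrict_space_iff) auto

lemma prob_space_unit_lborel: "prob_space unit_lborel"
  by standard (simp add: emeasure_unit_lborel)

interpretation U: prob_space unit_lborel by (rule prob_space_unit_lborel)

lemma measurable_unit_borel: "(\<lambda>x. x) \<in> unit_lborel \<rightarrow>\<^sub>M (borel :: real measure)"
  unfolding unit_lborel_def by (rule measurable_restrict_space1) simp

lemma sets_hist_bin [measurable]: "hist_bin k j \<in> sets borel"
  unfolding hist_bin_def by simp

lemma hist_bin_unique:
  assumes "x \<in> hist_bin k i" "x \<in> hist_bin k j" "i \<ge> 1" "j \<ge> 1" "k \<ge> 1"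
  shows "i = j"
proof -
  have *: "i \<le> j" if "x \<in> hist_bin k i" "x \<in> hist_bin k j" "i \<ge> 1" "j \<ge> 1" for i j
  proof (cases "i = 1")
    case False
    from that False have "real i - 1 < x * k" "x * k \<le> real j"
      using \<open>k \<ge> 1\<close> by (auto simp: hist_bin_def field_simps split: if_splits)
    then have "real i < real j + 1" by linarith
    then show ?thesis by linarith
  qed (use that in simp)
  show ?thesis using *[of i j] *[of j i] assms by simp
qed

lemma hist_bin_exists:
  assumes "x \<in> {0..1}" "k \<ge> 1"
  obtains j where "j \<in> {1..k}" "x \<in> hist_bin k j"
proof (cases "x \<le> 1 / real k")
  case True
  then show ?thesis using that[of 1] assms by (auto simp: hist_bin_def)
next
  case False
  \<comment> \<open>The first bin is closed on the left, so the ceiling is used only beyond it.\<close>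
  define j where "j = nat \<lceil>x * k\<rceil>"
  have x: "1 < x * k" "x * k \<le> k" using False assms by (auto simp: field_simps)
  then have j: "real j - 1 < x * k" "x * k \<le> real j" "j \<le> k" unfolding j_def by linarith+
  from x j have j1: "j > 1" by linarith
  have "(real j - 1) / real k < x" "x \<le> real j / real k"
    using x j(1,2) assms by (simp_all add: pos_divide_less_eq pos_le_divide_eq)
  with j1 j(3) have "x \<in> hist_bin k j" "j \<in> {1..k}" by (simp_all add: hist_bin_def)
  then show ?thesis by (rule that[rotated])
qed

lemma hist_bin_subset:
  assumes "j \<in> {1..k}"
  shows "hist_bin k j \<subseteq> {0..1}"
proof
  fix x assume x: "x \<in> hist_bin k j"
  have "0 \<le> (real j - 1) / real k" "real j / real k \<le> 1" "1 / real k \<le> 1"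
    using assms by (auto simp: field_simps)
  with x show "x \<in> {0..1}" by (auto simp: hist_bin_def split: if_splits)
qed

lemma emeasure_hist_bin: "j \<in> {1..k} \<Longrightarrow> emeasure lborel (hist_bin k j) = ennreal (1 / real k)"
  by (auto simp: hist_bin_def field_simps)

lemma hist_bin_dist:
  assumes "x \<in> hist_bin k j" "y \<in> hist_bin k j"
  shows "\<bar>x - y\<bar> \<le> 1 / real k"
proof -
  have "z \<in> {(real j - 1) / real k..real j / real k}" if "z \<in> hist_bin k j" for z
    using that by (auto simp: hist_bin_def split: if_splits)
  from this[OF assms(1)] this[OF assms(2)] show ?thesis
    by (auto simp: diff_divide_distrib)
qed

lemma same_bin_sym: "same_bin k x y \<longleftrightarrow> same_bin k y x"
  by (auto simp: same_bin_def)

text \<open>The bins partition the unit interval, so the relation "same bin" has the bins as its classes.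
  The half-open convention matters here: with closed bins the endpoints would lie in two bins.\<close>

lemma same_bin_eq_hist_bin:
  assumes "x \<in> {0..1}" "k \<ge> 1"
  obtains j where "j \<in> {1..k}" "{y. same_bin k x y} = hist_bin k j"
proof -
  obtain j where j: "j \<in> {1..k}" "x \<in> hist_bin k j" using assms by (rule hist_bin_exists)
  have "same_bin k x y \<longleftrightarrow> y \<in> hist_bin k j" for y
  proof
    assume "same_bin k x y"
    then obtain i where i: "i \<in> {1..k}" "x \<in> hist_bin k i" "y \<in> hist_bin k i"
      by (auto simp: same_bin_def)
    then have "i = j" using j assms(2) by (intro hist_bin_unique[of x k]) auto
    with i show "y \<in> hist_bin k j" by simp
  qed (use j in \<open>auto simp: same_bin_def\<close>)
  then have "{y. same_bin k x y} = hist_bin k j" by auto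
  with j show ?thesis using that by blast
qed

lemma emeasure_same_bin:
  assumes "x \<in> {0..1}" "k \<ge> 1"
  shows "emeasure unit_lborel {y. same_bin k x y} = ennreal (1 / real k)"
    and "{y. same_bin k x y} \<subseteq> {0..1}" "{y. same_bin k x y} \<in> sets borel"
proof -
  obtain j where j: "j \<in> {1..k}" "{y. same_bin k x y} = hist_bin k j"
    using assms by (rule same_bin_eq_hist_bin)
  show "emeasure unit_lborel {y. same_bin k x y} = ennreal (1 / real k)"
    using j emeasure_hist_bin[OF j(1)] hist_bin_subset[OF j(1)] emeasure_unit_lborel[OF sets_hist_bin] by simp
  show "{y. same_bin k x y} \<subseteq> {0..1}" "{y. same_bin k x y} \<in> sets borel"
    using j hist_bin_subset[OF j(1)] by simp_all
qed

lemma same_bin_dist: "same_bin k x y \<Longrightarrow> \<bar>x - y\<bar> \<le> 1 / real k"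
  using hist_bin_dist by (auto simp: same_bin_def)

lemma same_bin_measurable [measurable]: "Measurable.pred (borel \<Otimes>\<^sub>M borel) (\<lambda>(x, y). same_bin k x y)"
proof -
  have "{z. case z of (x, y) \<Rightarrow> same_bin k x y} = (\<Union>j\<in>{1..k}. hist_bin k j \<times> hist_bin k j)"
    by (auto simp: same_bin_def)
  also have "\<dots> \<in> sets (borel \<Otimes>\<^sub>M borel)"
    by (intro sets.finite_UN pair_measureI sets_hist_bin) simp
  finally show ?thesis unfolding pred_def by (simp add: space_pair_measure)
qed

lemma measurable_seq_component: "(\<lambda>\<omega>. \<omega> i) \<in> seq_space UNIV \<rightarrow>\<^sub>M unit_lborel"
  unfolding seq_space_def by (rule measurable_component_singleton) simp

lemma borel_measurable_seq_component [measurable]: "(\<lambda>\<omega>. \<omega> i) \<in> borel_measurable (seq_space UNIV)"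
  using measurable_compose[OF measurable_seq_component measurable_unit_borel] .

lemma space_seq_space: "space (seq_space UNIV) = {\<omega>. \<forall>i. \<omega> i \<in> {0..1}}"
  by (auto simp: seq_space_def space_PiM PiE_UNIV_domain)

lemma real_length_filter_map_upt:
  "real (length (filter Q (map \<omega> [0..<n]))) = (\<Sum>i<n. of_bool (Q (\<omega> i)))"
  by (induction n) auto

section \<open>Admissible strategies\<close>

text \<open>The bounds between \<open>1 / (n + 1)\<close> and \<open>n + 1\<close> hold for a histogram with any number of bins.
  Their form does not mention \<open>k\<close>, which is why they survive switching and mixing. They keep every
  log-loss below a bound that depends on the sample size only, so that all expectations exist.
  The integral condition says that the predictions are probability densities.\<close>

definition admissible :: "strategy \<Rightarrow> bool" where
  "admissible q \<longleftrightarrow>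
     (\<forall>xs y. 1 / (real (length xs) + 1) \<le> q xs y \<and> q xs y \<le> real (length xs) + 1) \<and>
     (\<forall>n. (\<lambda>\<omega>. q (map \<omega> [0..<n]) (\<omega> n)) \<in> borel_measurable (seq_space UNIV)) \<and>
     (\<forall>xs. set xs \<subseteq> {0..1} \<longrightarrow> (\<integral>\<^sup>+y. ennreal (q xs y) \<partial>unit_lborel) = 1)"

lemma admissible_lower: "admissible q \<Longrightarrow> 1 / (real (length xs) + 1) \<le> q xs y"
  and admissible_upper: "admissible q \<Longrightarrow> q xs y \<le> real (length xs) + 1"
  and admissible_measurable [measurable_dest]: "admissible q \<Longrightarrow> (\<lambda>\<omega>. q (map \<omega> [0..<n]) (\<omega> n)) \<in> borel_measurable (seq_space UNIV)"
  and admissible_integral: "admissible q \<Longrightarrow> set xs \<subseteq> {0..1} \<Longrightarrow> (\<integral>\<^sup>+y. ennreal (q xs y) \<partial>unit_lborel) = 1"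
  by (auto simp: admissible_def)

lemma admissible_pos: "admissible q \<Longrightarrow> 0 < q xs y"
  by (rule less_le_trans[OF _ admissible_lower]) (simp_all add: add_nonneg_pos)

text \<open>Each past outcome contributes to the count exactly when \<open>y\<close> falls into its bin, which has length
  \<open>1 / k\<close>.\<close>

lemma nn_integral_bin_count:
  assumes "set xs \<subseteq> {0..1}" "k \<ge> 1"
  shows "(\<lambda>y. ennreal (real (length (filter (\<lambda>x. same_bin k x y) xs)))) \<in> borel_measurable unit_lborel"
    and "(\<integral>\<^sup>+y. ennreal (real (length (filter (\<lambda>x. same_bin k x y) xs))) \<partial>unit_lborel)
         = ennreal (real (length xs) / real k)"
proof -
  have "(\<lambda>y. ennreal (real (length (filter (\<lambda>x. same_bin k x y) xs)))) \<in> borel_measurable unit_lborel \<and>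
    (\<integral>\<^sup>+y. ennreal (real (length (filter (\<lambda>x. same_bin k x y) xs))) \<partial>unit_lborel)
         = ennreal (real (length xs) / real k)"
    using assms(1)
  proof (induction xs)
    case (Cons x xs)
    let ?A = "{y. same_bin k x y}"
    have A: "?A \<in> sets unit_lborel" "emeasure unit_lborel ?A = ennreal (1 / real k)"
      using emeasure_same_bin[of x k] Cons.prems assms(2) by (auto intro: sets_unit_lborel)
    have *: "ennreal (real (length (filter (\<lambda>x. same_bin k x y) (x # xs))))
        = indicator ?A y + ennreal (real (length (filter (\<lambda>x. same_bin k x y) xs)))" for y
      by (auto simp: indicator_def simp flip: ennreal_1 ennreal_plus)
    have IH: "(\<lambda>y. ennreal (real (length (filter (\<lambda>x. same_bin k x y) xs)))) \<in> borel_measurable unit_lborel"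
      "(\<integral>\<^sup>+y. ennreal (real (length (filter (\<lambda>x. same_bin k x y) xs))) \<partial>unit_lborel)
         = ennreal (real (length xs) / real k)"
      using Cons by auto
    show ?case unfolding *
      using A IH by (auto simp: nn_integral_add add_divide_distrib simp flip: ennreal_plus)
  qed simp
  then show "(\<lambda>y. ennreal (real (length (filter (\<lambda>x. same_bin k x y) xs)))) \<in> borel_measurable unit_lborel"
    and "(\<integral>\<^sup>+y. ennreal (real (length (filter (\<lambda>x. same_bin k x y) xs))) \<partial>unit_lborel)
         = ennreal (real (length xs) / real k)" by auto
qed

lemma admissible_histogram:
  assumes "k \<ge> 1"
  shows "admissible (histogram k)"
  unfolding admissible_def
proof (intro conjI allI impI)
  fix xs :: "real list" and y :: real
  let ?c = "length (filter (\<lambda>x. same_bin k x y) xs)" and ?n = "real (length xs)"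
  have c: "real ?c \<le> ?n" using length_filter_le of_nat_le_iff by blast
  have k: "real k \<ge> 1" "?n + real k > 0" using assms by (auto intro: add_nonneg_pos)
  have nk: "?n \<le> ?n * real k" using k mult_left_mono[of 1 "real k" ?n] by simp
  have "?n + real k \<le> (real ?c + 1) * real k * (?n + 1)"
  proof -
    have "?n + real k \<le> real k * (?n + 1)" using nk by (simp add: algebra_simps)
    also have "\<dots> \<le> (real ?c + 1) * (real k * (?n + 1))"
      using mult_right_mono[of 1 "real ?c + 1" "real k * (?n + 1)"] by simp
    finally show ?thesis by (simp add: mult.assoc)
  qed
  then show "1 / (?n + 1) \<le> histogram k xs y"
    using k by (simp add: histogram_def divide_simps add.commute) 
  have "(real ?c + 1) * real k \<le> (?n + 1) * (?n + real k)"
    using c k by (intro mult_mono) auto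
  then show "histogram k xs y \<le> ?n + 1"
    using k by (simp add: histogram_def pos_divide_le_eq)
next
  fix n
  have "(\<lambda>\<omega>. same_bin k (\<omega> i) (\<omega> n)) \<in> measurable (seq_space UNIV) (count_space UNIV)" for i
    using measurable_compose[OF measurable_Pair[OF borel_measurable_seq_component[of i] borel_measurable_seq_component[of n]]
         same_bin_measurable[of k]] by simp
  then show "(\<lambda>\<omega>. histogram k (map \<omega> [0..<n]) (\<omega> n)) \<in> borel_measurable (seq_space UNIV)"
    unfolding histogram_def real_length_filter_map_upt by (simp del: sum_of_bool_eq)
next
  fix xs :: "real list" assume xs: "set xs \<subseteq> {0..1}"
  let ?n = "real (length xs)"
  have k: "real k \<ge> 1" "?n + real k > 0" using assms by (auto intro: add_nonneg_pos)
  have eq: "ennreal (histogram k xs y) = (ennreal (real (length (filter (\<lambda>x. same_bin k x y) xs))) + 1) *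
      ennreal (real k / (?n + real k))" for y
    using k by (simp add: histogram_def flip: ennreal_1 ennreal_plus ennreal_mult)
  have "(\<integral>\<^sup>+y. ennreal (histogram k xs y) \<partial>unit_lborel) = (ennreal (?n / real k) + 1) * ennreal (real k / (?n + real k))"
    unfolding eq using nn_integral_bin_count[OF xs assms]
    by (simp add: nn_integral_multc nn_integral_add U.emeasure_space_1[simplified])
  also have "\<dots> = ennreal ((?n / real k + 1) * (real k / (?n + real k)))"
    using k by (simp add: divide_nonneg_nonneg flip: ennreal_1 ennreal_plus ennreal_mult)
  also have "(?n / real k + 1) * (real k / (?n + real k)) = 1"
  proof -
    have "?n / real k + 1 = (?n + real k) / real k" using k by (simp add: add_divide_distrib)
    then show ?thesis using k by simp
  qed
  finally show "(\<integral>\<^sup>+y. ennreal (histogram k xs y) \<partial>unit_lborel) = 1" by simp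
qed

lemma joint_density_Nil [simp]: "joint_density q [] = 1"
  by (simp add: joint_density_def)

lemma joint_density_snoc: "joint_density q (xs @ [y]) = joint_density q xs * q xs y"
  by (simp add: joint_density_def nth_append)

lemma joint_density_pos: "admissible q \<Longrightarrow> 0 < joint_density q xs"
  by (simp add: joint_density_def prod_pos admissible_pos)

lemma joint_density_le: "admissible q \<Longrightarrow> joint_density q xs \<le> fact (length xs)"
proof (induction xs rule: rev_induct)
  case (snoc y xs)
  have "joint_density q xs * q xs y \<le> fact (length xs) * (real (length xs) + 1)"
    using snoc admissible_upper[OF snoc.prems, of xs y] admissible_pos[OF snoc.prems, of xs y] by (intro mult_mono) auto
  then show ?case by (simp add: joint_density_snoc algebra_simps)
qed simp

lemma joint_density_map_measurable:
  assumes [measurable]: "admissible q"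
  shows "(\<lambda>\<omega>. joint_density q (map \<omega> [0..<n])) \<in> borel_measurable (seq_space UNIV)"
proof (induction n)
  case (Suc n)
  note [measurable] = Suc
  show ?case by (simp add: joint_density_snoc)
qed simp

section \<open>The expert in charge\<close>

lemma switch_params_sorted: "s \<in> switch_params \<Longrightarrow> i < j \<Longrightarrow> j < length s \<Longrightarrow> fst (s ! i) < fst (s ! j)"
  by (auto simp: switch_params_def sorted_wrt_iff_nth_less)

lemma switch_params_expert: "s \<in> switch_params \<Longrightarrow> i < length s \<Longrightarrow> 1 \<le> snd (s ! i)"
  using nth_mem by (fastforce simp: switch_params_def)

text \<open>Switch times increase strictly, so the stretches between consecutive switch times are disjoint.\<close>

lemma active_index_eqI:
  assumes s: "s \<in> switch_params" and i: "i < length s" "fst (s ! i) \<le> n"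
    and "Suc i = length s \<or> fst (s ! Suc i) > n"
  shows "active_index s n = i"
  unfolding active_index_def
proof (rule the_equality)
  fix j assume j: "j < length s \<and> fst (s ! j) \<le> n \<and> (Suc j = length s \<or> fst (s ! Suc j) > n)"
  have "\<not> a < b" if "b < length s" "fst (s ! b) \<le> n" "Suc a = length s \<or> fst (s ! Suc a) > n" for a b
  proof
    assume ab: "a < b"
    then have "fst (s ! Suc a) \<le> fst (s ! b)"
      using switch_params_sorted[OF s, of "Suc a" b] that by (cases "Suc a = b") auto
    with that ab show False by auto
  qed
  with j assms have "\<not> i < j" "\<not> j < i" by blast+
  then show "j = i" by simp
qed (use assms in auto)

lemma active_index_less:
  assumes s: "s \<in> switch_params"
  shows "active_index s n < length s"
proof -
  \<comment> \<open>The entry in charge is the last one whose switch time has been reached.\<close>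
  define A where "A = {i. i < length s \<and> fst (s ! i) \<le> n}"
  have "finite A" "0 \<in> A" using s by (auto simp: A_def switch_params_def)
  then have M: "Max A \<in> A" "\<And>i. i \<in> A \<Longrightarrow> i \<le> Max A" using Max_in by auto
  then have "Suc (Max A) \<notin> A" by force
  with M have "active_index s n = Max A"
    by (intro active_index_eqI s) (auto simp: A_def)
  with M show ?thesis by (simp add: A_def)
qed

lemma admissible_switch_strategy:
  assumes p: "\<And>k. k \<ge> 1 \<Longrightarrow> admissible (p k)" and s: "s \<in> switch_params"
  shows "admissible (switch_strategy p s)"
proof -
  have *: "admissible (p (snd (s ! active_index s n)))" for n
    using p switch_params_expert active_index_less s by blast
  show ?thesis unfolding admissible_def switch_strategy_def
    using *[THEN admissible_lower] *[THEN admissible_upper] *[THEN admissible_measurable]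
      *[THEN admissible_integral] by auto
qed

section \<open>The switch distribution as a mixture\<close>

lemma nn_integral_count_space_infsum:
  fixes f :: "'a \<Rightarrow> real"
  assumes "f summable_on A" "\<And>x. x \<in> A \<Longrightarrow> 0 \<le> f x"
  shows "(\<integral>\<^sup>+x. ennreal (f x) \<partial>count_space A) = ennreal (infsum f A)"
proof -
  have "(\<lambda>x. norm (f x)) summable_on A"
    using assms by (subst summable_on_cong[where g = f]) auto
  then have "Infinite_Set_Sum.abs_summable_on f A" by (simp only: abs_summable_equivalent)
  with assms show ?thesis by (simp add: nn_integral_conv_infsetsum infsetsum_infsum)
qed

lemma countable_switch_params: "countable switch_params"
  by (rule countable_subset[OF subset_UNIV]) simp

lemma measurable_seq_upd:
  assumes "\<omega> \<in> space (seq_space UNIV)"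
  shows "(fun_upd \<omega> n) \<in> unit_lborel \<rightarrow>\<^sub>M seq_space UNIV"
  using assms unfolding seq_space_def by (intro measurable_fun_upd) auto

lemma map_upd_upt: "map (fun_upd \<omega> n y) [0..<n] = map \<omega> [0..<n]"
  by simp

text \<open>A fixed past \<open>xs\<close> is the beginning of some sequence, so measurability in the last outcome is
  inherited from measurability in the whole sequence.\<close>

lemma admissible_measurable_section:
  assumes q: "admissible q" and xs: "set xs \<subseteq> {0..1}"
  shows "(\<lambda>y. q xs y) \<in> borel_measurable unit_lborel"
proof -
  define n where "n = length xs"
  define \<omega> where "\<omega> i = (if i < n then xs ! i else 0)" for i
  have "map \<omega> [0..<n] = xs"
    by (rule nth_equalityI) (auto simp: \<omega>_def n_def)
  then have *: "q xs y = q (map (fun_upd \<omega> n y) [0..<n]) (fun_upd \<omega> n y n)" for y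
    by (simp add: map_upd_upt)
  have "\<omega> \<in> space (seq_space UNIV)"
    using xs by (auto simp: space_seq_space \<omega>_def n_def dest!: nth_mem)
  from measurable_compose[OF measurable_seq_upd[OF this] admissible_measurable[OF q]]
  show ?thesis unfolding * .
qed

text \<open>Summability of the prior is essential: without it the infinite sum that defines the switch density
  would be the default value \<open>0\<close>.\<close>

locale expert_mixture =
  fixes p :: "nat \<Rightarrow> strategy" and \<pi> :: "(nat \<times> nat) list \<Rightarrow> real"
  assumes admissible_expert: "k \<ge> 1 \<Longrightarrow> admissible (p k)"
    and prior_nonneg: "s \<in> switch_params \<Longrightarrow> 0 \<le> \<pi> s"
    and prior_summable: "\<pi> summable_on switch_params"
    and prior_nontrivial: "\<exists>s\<in>switch_params. 0 < \<pi> s"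
begin

abbreviation "qs \<equiv> switch_strategy p"

lemma admissible_qs: "s \<in> switch_params \<Longrightarrow> admissible (qs s)"
  by (intro admissible_switch_strategy admissible_expert)

lemma term_nonneg: "s \<in> switch_params \<Longrightarrow> 0 \<le> joint_density (qs s) xs * \<pi> s"
  using joint_density_pos[OF admissible_qs, of s xs] prior_nonneg by simp

text \<open>A strategy that is bounded by \<open>j + 1\<close> after \<open>j\<close> outcomes has joint density at most \<open>n!\<close>, whichever
  switch sequence it follows. Hence the prior dominates the series.\<close>

lemma term_summable: "(\<lambda>s. joint_density (qs s) xs * \<pi> s) summable_on switch_params"
proof (rule summable_on_comparison_test)
  show "(\<lambda>s. fact (length xs) * \<pi> s) summable_on switch_params"
    by (intro summable_on_cmult_right prior_summable)
qed (use term_nonneg joint_density_le[OF admissible_qs] prior_nonneg in \<open>auto intro: mult_right_mono\<close>)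

text \<open>A mixture exceeds each of its weighted components. This is the only lower bound on the switch
  density that the regret analysis needs.\<close>

lemma switch_density_ge:
  assumes "s \<in> switch_params"
  shows "joint_density (qs s) xs * \<pi> s \<le> switch_density p \<pi> xs"
  using finite_sum_le_infsum[OF term_summable, of "{s}" xs] assms term_nonneg
  by (auto simp: switch_density_def)

lemma switch_density_pos: "0 < switch_density p \<pi> xs"
proof -
  obtain s where s: "s \<in> switch_params" "0 < \<pi> s" using prior_nontrivial by blast
  have "0 < joint_density (qs s) xs * \<pi> s"
    using s joint_density_pos[OF admissible_qs] by simp
  also have "\<dots> \<le> switch_density p \<pi> xs" by (rule switch_density_ge[OF s(1)])
  finally show ?thesis .
qed

text \<open>Admissibility bounds hold term by term and hence for the posterior average.\<close>

lemma switch_density_snoc_bounds: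
  "1 / (real (length xs) + 1) * switch_density p \<pi> xs \<le> switch_density p \<pi> (xs @ [y])" (is ?lower)
  "switch_density p \<pi> (xs @ [y]) \<le> (real (length xs) + 1) * switch_density p \<pi> xs" (is ?upper)
proof -
  let ?n = "real (length xs)"
  have "1 / (?n + 1) * switch_density p \<pi> xs = (\<Sum>\<^sub>\<infinity>s\<in>switch_params. 1 / (?n + 1) * (joint_density (qs s) xs * \<pi> s))"
    unfolding switch_density_def by (rule infsum_cmult_right'[symmetric])
  also have "\<dots> \<le> switch_density p \<pi> (xs @ [y])"
    unfolding switch_density_def
  proof (rule infsum_mono[OF summable_on_cmult_right[OF term_summable] term_summable])
    fix s assume s: "s \<in> switch_params"
    have "1 / (?n + 1) * (joint_density (qs s) xs * \<pi> s) \<le> qs s xs y * (joint_density (qs s) xs * \<pi> s)"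
      by (intro mult_right_mono admissible_lower admissible_qs s term_nonneg)
    then show "1 / (?n + 1) * (joint_density (qs s) xs * \<pi> s) \<le> joint_density (qs s) (xs @ [y]) * \<pi> s"
      by (simp add: joint_density_snoc mult_ac)
  qed
  finally show ?lower .
  have "switch_density p \<pi> (xs @ [y]) \<le> (\<Sum>\<^sub>\<infinity>s\<in>switch_params. (?n + 1) * (joint_density (qs s) xs * \<pi> s))"
    unfolding switch_density_def
  proof (rule infsum_mono[OF term_summable summable_on_cmult_right[OF term_summable]])
    fix s assume s: "s \<in> switch_params"
    have "qs s xs y * (joint_density (qs s) xs * \<pi> s) \<le> (?n + 1) * (joint_density (qs s) xs * \<pi> s)"
      by (intro mult_right_mono admissible_upper admissible_qs s term_nonneg)
    then show "joint_density (qs s) (xs @ [y]) * \<pi> s \<le> (?n + 1) * (joint_density (qs s) xs * \<pi> s)"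
      by (simp add: joint_density_snoc mult_ac)
  qed
  also have "\<dots> = (?n + 1) * switch_density p \<pi> xs"
    unfolding switch_density_def by (rule infsum_cmult_right')
  finally show ?upper .
qed

text \<open>Reading the series as an integral over a countable space makes measurability and the exchange
  with the integral over the next outcome instances of Fubini's theorem.\<close>

lemma switch_density_conv_nn_integral:
  "ennreal (switch_density p \<pi> xs) = (\<integral>\<^sup>+s. ennreal (joint_density (qs s) xs * \<pi> s) \<partial>count_space switch_params)"
  unfolding switch_density_def
  by (rule nn_integral_count_space_infsum[OF term_summable term_nonneg, symmetric])

lemma switch_density_measurable:
  "(\<lambda>\<omega>. switch_density p \<pi> (map \<omega> [0..<n])) \<in> borel_measurable (seq_space UNIV)"
proof -
  interpret C: sigma_finite_measure "count_space switch_params"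
    by (rule sigma_finite_measure_count_space_countable[OF countable_switch_params])
  have m: "(\<lambda>\<omega>. ennreal (joint_density (qs s) (map \<omega> [0..<n]) * \<pi> s)) \<in> borel_measurable (seq_space UNIV)"
    if "s \<in> switch_params" for s
    using joint_density_map_measurable[OF admissible_qs[OF that], of n] by measurable
  have "(\<lambda>(\<omega>, s). ennreal (joint_density (qs s) (map \<omega> [0..<n]) * \<pi> s))
      \<in> borel_measurable (seq_space UNIV \<Otimes>\<^sub>M count_space switch_params)"
    unfolding measurable_pair_swap_iff[of _ "seq_space UNIV"]
    by (rule measurable_pair_measure_countable1[OF countable_switch_params]) (simp add: m)
  then have "(\<lambda>\<omega>. \<integral>\<^sup>+s. ennreal (joint_density (qs s) (map \<omega> [0..<n]) * \<pi> s) \<partial>count_space switch_params)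
      \<in> borel_measurable (seq_space UNIV)"
    by (rule C.borel_measurable_nn_integral)
  then have "(\<lambda>\<omega>. enn2real (ennreal (switch_density p \<pi> (map \<omega> [0..<n])))) \<in> borel_measurable (seq_space UNIV)"
    unfolding switch_density_conv_nn_integral by measurable
  then show ?thesis using switch_density_pos by (simp add: less_imp_le)
qed

lemma nn_integral_switch_density_snoc:
  assumes xs: "set xs \<subseteq> {0..1}"
  shows "(\<integral>\<^sup>+y. ennreal (switch_density p \<pi> (xs @ [y])) \<partial>unit_lborel) = ennreal (switch_density p \<pi> xs)"
proof -
  interpret C: sigma_finite_measure "count_space switch_params"
    by (rule sigma_finite_measure_count_space_countable[OF countable_switch_params])
  have m: "(\<lambda>y. ennreal (joint_density (qs s) xs * \<pi> s) * ennreal (qs s xs y)) \<in> borel_measurable unit_lborel"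
    if "s \<in> switch_params" for s
    using admissible_measurable_section[OF admissible_qs[OF that] xs] by measurable
  interpret UC: pair_sigma_finite "count_space switch_params" unit_lborel ..
  have "(\<integral>\<^sup>+y. ennreal (switch_density p \<pi> (xs @ [y])) \<partial>unit_lborel) =
     (\<integral>\<^sup>+y. \<integral>\<^sup>+s. ennreal (joint_density (qs s) xs * \<pi> s) * ennreal (qs s xs y) \<partial>count_space switch_params \<partial>unit_lborel)"
    unfolding switch_density_conv_nn_integral
  proof (intro nn_integral_cong)
    fix y s assume "s \<in> space (count_space switch_params)"
    then have "0 \<le> joint_density (qs s) xs * \<pi> s" "0 \<le> qs s xs y"
      using term_nonneg admissible_pos[OF admissible_qs, of s xs y] by auto
    then show "ennreal (joint_density (qs s) (xs @ [y]) * \<pi> s)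
        = ennreal (joint_density (qs s) xs * \<pi> s) * ennreal (qs s xs y)"
      by (simp add: joint_density_snoc mult_ac flip: ennreal_mult)
  qed
  also have "\<dots> = (\<integral>\<^sup>+s. \<integral>\<^sup>+y. ennreal (joint_density (qs s) xs * \<pi> s) * ennreal (qs s xs y) \<partial>unit_lborel \<partial>count_space switch_params)"
  proof (rule UC.Fubini')
    show "(\<lambda>(s, y). ennreal (joint_density (qs s) xs * \<pi> s) * ennreal (qs s xs y))
        \<in> borel_measurable (count_space switch_params \<Otimes>\<^sub>M unit_lborel)"
      by (rule measurable_pair_measure_countable1[OF countable_switch_params])
         (simp add: m)
  qed
  also have "\<dots> = (\<integral>\<^sup>+s. ennreal (joint_density (qs s) xs * \<pi> s) \<partial>count_space switch_params)"
  proof (rule nn_integral_cong)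
    fix s assume "s \<in> space (count_space switch_params)"
    then have a: "admissible (qs s)" by (auto intro: admissible_qs)
    show "(\<integral>\<^sup>+y. ennreal (joint_density (qs s) xs * \<pi> s) * ennreal (qs s xs y) \<partial>unit_lborel)
        = ennreal (joint_density (qs s) xs * \<pi> s)"
      using admissible_measurable_section[OF a xs] admissible_integral[OF a xs] by (simp add: nn_integral_cmult)
  qed
  finally show ?thesis by (simp add: switch_density_conv_nn_integral)
qed

lemma admissible_switch_distribution: "admissible (switch_distribution p \<pi>)"
  unfolding admissible_def
proof (intro conjI allI impI)
  fix xs y
  show "1 / (real (length xs) + 1) \<le> switch_distribution p \<pi> xs y"
    "switch_distribution p \<pi> xs y \<le> real (length xs) + 1"
    using switch_density_snoc_bounds[of xs y] switch_density_pos[of xs]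
    unfolding switch_distribution_def by (simp_all only: pos_le_divide_eq pos_divide_le_eq)
next
  fix n
  have "map \<omega> [0..<n] @ [\<omega> n] = map \<omega> [0..<Suc n]" for \<omega> :: "nat \<Rightarrow> real" by simp
  then show "(\<lambda>\<omega>. switch_distribution p \<pi> (map \<omega> [0..<n]) (\<omega> n)) \<in> borel_measurable (seq_space UNIV)"
    unfolding switch_distribution_def using switch_density_measurable[of n] switch_density_measurable[of "Suc n"]
    by (simp only: borel_measurable_divide)
next
  fix xs :: "real list" assume xs: "set xs \<subseteq> {0..1}"
  let ?Z = "switch_density p \<pi> xs"
  define h where "h = (\<lambda>y. ennreal (switch_density p \<pi> (xs @ [y])))"
  have "ennreal (switch_distribution p \<pi> xs y) = h y * ennreal (1 / ?Z)" for y
    using switch_density_pos[of xs] switch_density_pos[of "xs @ [y]"]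
    by (simp add: switch_distribution_def h_def less_imp_le flip: ennreal_mult)
  moreover have "h \<in> borel_measurable unit_lborel"
  proof -
    define n where "n = length xs"
    define \<omega> where "\<omega> i = (if i < n then xs ! i else 0)" for i
    have "map \<omega> [0..<n] = xs"
      by (rule nth_equalityI) (auto simp: \<omega>_def n_def)
    then have *: "xs @ [y] = map (fun_upd \<omega> n y) [0..<Suc n]" for y
      by simp
    have "\<omega> \<in> space (seq_space UNIV)"
      using xs by (auto simp: space_seq_space \<omega>_def n_def dest!: nth_mem)
    from measurable_compose[OF measurable_seq_upd[OF this, of n] switch_density_measurable[of "Suc n"]]
    show ?thesis unfolding h_def * by measurable
  qed
  ultimately have "(\<integral>\<^sup>+y. ennreal (switch_distribution p \<pi> xs y) \<partial>unit_lborel) = ennreal ?Z * ennreal (1 / ?Z)"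
    using nn_integral_switch_density_snoc[OF xs] by (simp add: nn_integral_multc h_def)
  also have "\<dots> = 1" using switch_density_pos[of xs] by (simp flip: ennreal_mult)
  finally show "(\<integral>\<^sup>+y. ennreal (switch_distribution p \<pi> xs y) \<partial>unit_lborel) = 1" .
qed

text \<open>The conditionals telescope. The denominator is the total mass of the prior.\<close>

lemma joint_density_switch_distribution:
  "joint_density (switch_distribution p \<pi>) xs = switch_density p \<pi> xs / switch_density p \<pi> []"
proof (induction xs rule: rev_induct)
  case Nil
  show ?case using switch_density_pos[of "[]"] by simp
next
  case (snoc y xs)
  then show ?case using switch_density_pos[of xs] by (simp add: joint_density_snoc switch_distribution_def)
qed

end

section \<open>The product prior\<close>

lemma prob_after_pos:
  fixes \<pi>T :: "nat pmf"
  assumes "set_pmf \<pi>T = {1..}"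
  shows "0 < measure_pmf.prob \<pi>T {t'<..}"
proof -
  have "0 < pmf \<pi>T (Suc t')" using assms by (simp add: pmf_positive)
  also have "\<dots> = measure_pmf.prob \<pi>T {Suc t'}" by (simp add: measure_pmf_single)
  also have "\<dots> \<le> measure_pmf.prob \<pi>T {t'<..}" by (intro measure_pmf.finite_measure_mono) auto
  finally show ?thesis .
qed

lemma pmf_after_nonneg: "0 \<le> pmf_after \<pi>T t' t"
  by (simp add: pmf_after_def)

text \<open>Conditioning only increases the mass, so the price of a switch time is never more than its
  unconditional price.\<close>

lemma pmf_le_pmf_after:
  assumes "set_pmf \<pi>T = {1..}"
  shows "pmf \<pi>T t \<le> pmf_after \<pi>T t' t"
  using prob_after_pos[OF assms, of t'] measure_pmf.prob_le_1[of \<pi>T "{t'<..}"]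
    mult_left_mono[of "measure_pmf.prob \<pi>T {t'<..}" 1 "pmf \<pi>T t"]
  by (simp add: pmf_after_def pos_le_divide_eq)

lemma sum_pmf_le_1: "finite F \<Longrightarrow> sum (pmf p) F \<le> 1"
  using measure_measure_pmf_finite[of F p] measure_pmf.prob_le_1[of p F] by simp

lemma sum_pmf_after_le_1:
  assumes T: "set_pmf \<pi>T = {1..}" and F: "finite F" "\<And>t. t \<in> F \<Longrightarrow> t' < t"
  shows "(\<Sum>t\<in>F. pmf_after \<pi>T t' t) \<le> 1"
proof -
  have "(\<Sum>t\<in>F. pmf \<pi>T t) \<le> measure_pmf.prob \<pi>T {t'<..}"
    using F measure_measure_pmf_finite[of F \<pi>T] measure_pmf.finite_measure_mono[of F "{t'<..}" \<pi>T] by auto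
  with prob_after_pos[OF T, of t'] show ?thesis
    by (simp add: pmf_after_def flip: sum_divide_distrib)
qed

text \<open>The prior without its factor for the number of switches.\<close>

definition path_weight :: "nat pmf \<Rightarrow> nat pmf \<Rightarrow> (nat \<times> nat) list \<Rightarrow> real" where
  "path_weight \<pi>K \<pi>T s = pmf \<pi>K (snd (s ! 0)) *
     (\<Prod>i\<in>{1..<length s}. pmf_after \<pi>T (fst (s ! (i - 1))) (fst (s ! i)) * pmf \<pi>K (snd (s ! i)))"

lemma path_weight_nonneg: "0 \<le> path_weight \<pi>K \<pi>T s"
  by (simp add: path_weight_def prod_nonneg pmf_after_nonneg)

lemma path_weight_snoc:
  assumes "s \<noteq> []"
  shows "path_weight \<pi>K \<pi>T (s @ [e]) =
    path_weight \<pi>K \<pi>T s * (pmf_after \<pi>T (fst (last s)) (fst e) * pmf \<pi>K (snd e))"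
proof -
  obtain m where m: "length s = Suc m" using assms by (cases s) auto
  let ?w = "\<lambda>s i. pmf_after \<pi>T (fst (s ! (i - 1))) (fst (s ! i)) * pmf \<pi>K (snd (s ! i))"
  have "{1..<length (s @ [e])} = insert (length s) {1..<length s}" using m by auto
  moreover have "(\<Prod>i\<in>{1..<length s}. ?w (s @ [e]) i) = (\<Prod>i\<in>{1..<length s}. ?w s i)"
    by (intro prod.cong) (auto simp: nth_append)
  moreover have "last s = s ! m" using m assms by (simp add: last_conv_nth)
  ultimately show ?thesis
    using m by (simp add: path_weight_def nth_append)
qed

lemma product_prior_eq: "product_prior \<pi>M \<pi>K \<pi>T s = pmf \<pi>M (length s) * path_weight \<pi>K \<pi>T s"
  by (simp add: product_prior_def path_weight_def)

text \<open>Splitting off the last switch, whose conditional mass sums to at most one for every past, gives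
  the bound by induction on the length. Finite sets \<open>F\<close> suffice, and each is enlarged to one of the
  form \<open>butlast\<close> times possible continuations, on which the double sum factorizes.\<close>

lemma sum_path_weight_le_1:
  assumes T: "set_pmf \<pi>T = {1..}"
  shows "finite F \<Longrightarrow> F \<subseteq> {s \<in> switch_params. length s = Suc m} \<Longrightarrow> sum (path_weight \<pi>K \<pi>T) F \<le> 1"
proof (induction m arbitrary: F)
  case 0
  have inj: "inj_on (\<lambda>s. snd (s ! 0)) F"
  proof (rule inj_onI)
    fix s s' assume "s \<in> F" "s' \<in> F" "snd (s ! 0) = snd (s' ! 0)"
    moreover from this 0 have "length s = 1" "length s' = 1" "fst (s ! 0) = 0" "fst (s' ! 0) = 0"
      by (auto simp: switch_params_def)
    ultimately show "s = s'" by (intro nth_equalityI) (auto simp: prod_eq_iff)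
  qed
  have "sum (path_weight \<pi>K \<pi>T) F = (\<Sum>s\<in>F. pmf \<pi>K (snd (s ! 0)))"
    using 0 by (intro sum.cong) (auto simp: path_weight_def)
  also have "\<dots> = sum (pmf \<pi>K) ((\<lambda>s. snd (s ! 0)) ` F)"
    using inj by (simp add: sum.reindex)
  also have "\<dots> \<le> 1" using 0 by (intro sum_pmf_le_1) auto
  finally show ?case .
next
  case (Suc m)
  define B where "B = butlast ` F"
  define E where "E b = {e \<in> last ` F. fst (last b) < fst e}" for b :: "(nat \<times> nat) list"
  have fin: "finite B" "\<And>b. finite (E b)" using Suc.prems by (auto simp: B_def E_def)
  have s: "s \<noteq> []" "butlast s \<noteq> []" "butlast s \<in> switch_params" "length (butlast s) = Suc m"
    "fst (last (butlast s)) < fst (last s)" if "s \<in> F" for s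
  proof -
    from that Suc.prems have sp: "s \<in> switch_params" and l: "length s = Suc (Suc m)" by auto
    then show 1: "s \<noteq> []" "butlast s \<noteq> []" "length (butlast s) = Suc m" by (auto simp: butlast_conv_take)
    have "s = butlast s @ [last s]" using 1 by simp
    then have w: "sorted_wrt (<) (map fst (butlast s) @ [fst (last s)])" 
      using sp by (metis (mono_tags, lifting) list.simps(8,9) map_append mem_Collect_eq switch_params_def)
    with sp l 1 show "butlast s \<in> switch_params"
      by (auto simp: switch_params_def sorted_wrt_append nth_butlast dest: in_set_butlastD)
    show "fst (last (butlast s)) < fst (last s)"
      using w 1 by (auto simp: sorted_wrt_append)
  qed
  have sub: "F \<subseteq> (\<lambda>(b, e). b @ [e]) ` Sigma B E"
  proof
    fix x assume "x \<in> F"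
    then have "x = (\<lambda>(b, e). b @ [e]) (butlast x, last x)" "(butlast x, last x) \<in> Sigma B E"
      using s[of x] by (auto simp: B_def E_def)
    then show "x \<in> (\<lambda>(b, e). b @ [e]) ` Sigma B E" by blast
  qed
  have inner: "(\<Sum>e\<in>E b. pmf_after \<pi>T (fst (last b)) (fst e) * pmf \<pi>K (snd e)) \<le> 1" for b
  proof -
    have "(\<Sum>e\<in>E b. pmf_after \<pi>T (fst (last b)) (fst e) * pmf \<pi>K (snd e))
       \<le> (\<Sum>e\<in>fst ` E b \<times> snd ` E b. pmf_after \<pi>T (fst (last b)) (fst e) * pmf \<pi>K (snd e))"
      using fin by (intro sum_mono2 subset_fst_snd) (auto simp: pmf_after_nonneg)
    also have "\<dots> = (\<Sum>t\<in>fst ` E b. pmf_after \<pi>T (fst (last b)) t) * (\<Sum>k\<in>snd ` E b. pmf \<pi>K k)"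
      by (simp add: sum_product sum.cartesian_product split_beta)
    also have "\<dots> \<le> 1 * 1"
      using fin by (intro mult_mono sum_pmf_after_le_1 T sum_pmf_le_1 sum_nonneg) (auto simp: E_def)
    finally show ?thesis by simp
  qed
  have "sum (path_weight \<pi>K \<pi>T) F \<le> sum (path_weight \<pi>K \<pi>T) ((\<lambda>(b, e). b @ [e]) ` Sigma B E)"
    using fin sub by (intro sum_mono2) (auto simp: path_weight_nonneg)
  also have "\<dots> = (\<Sum>(b, e)\<in>Sigma B E. path_weight \<pi>K \<pi>T (b @ [e]))"
    by (subst sum.reindex) (auto intro!: inj_onI sum.cong)
  also have "\<dots> = (\<Sum>b\<in>B. \<Sum>e\<in>E b. path_weight \<pi>K \<pi>T b * (pmf_after \<pi>T (fst (last b)) (fst e) * pmf \<pi>K (snd e)))"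
    using fin s by (subst sum.Sigma[symmetric]) (auto simp: B_def path_weight_snoc intro!: sum.cong)
  also have "\<dots> = (\<Sum>b\<in>B. path_weight \<pi>K \<pi>T b * (\<Sum>e\<in>E b. pmf_after \<pi>T (fst (last b)) (fst e) * pmf \<pi>K (snd e)))"
    by (simp add: sum_distrib_left)
  also have "\<dots> \<le> (\<Sum>b\<in>B. path_weight \<pi>K \<pi>T b * 1)"
    by (intro sum_mono mult_left_mono inner path_weight_nonneg)
  also have "\<dots> \<le> 1"
  proof -
    have "B \<subseteq> {s \<in> switch_params. length s = Suc m}" using s(3,4) by (auto simp: B_def simp del: length_butlast)
    from Suc.IH[OF fin(1) this] show ?thesis by simp
  qed
  finally show ?case .
qed

lemma sum_product_prior_le_1:
  assumes T: "set_pmf \<pi>T = {1..}" and F: "finite F" "F \<subseteq> switch_params"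
  shows "sum (product_prior \<pi>M \<pi>K \<pi>T) F \<le> 1"
proof -
  have "sum (product_prior \<pi>M \<pi>K \<pi>T) F =
      (\<Sum>m\<in>length ` F. \<Sum>s\<in>{s \<in> F. length s = m}. product_prior \<pi>M \<pi>K \<pi>T s)"
    using F by (intro sum.image_gen)
  also have "\<dots> = (\<Sum>m\<in>length ` F. pmf \<pi>M m * sum (path_weight \<pi>K \<pi>T) {s \<in> F. length s = m})"
    by (auto simp: product_prior_eq sum_distrib_left intro!: sum.cong)
  also have "\<dots> \<le> (\<Sum>m\<in>length ` F. pmf \<pi>M m * 1)"
  proof (intro sum_mono mult_left_mono)
    fix m assume "m \<in> length ` F"
    with F have "m \<noteq> 0" by (auto simp: switch_params_def)
    then obtain m' where m': "m = Suc m'" by (cases m) auto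
    show "sum (path_weight \<pi>K \<pi>T) {s \<in> F. length s = m} \<le> 1"
      using F by (intro sum_path_weight_le_1[OF T, of _ m']) (auto simp: m')
  qed simp
  also have "\<dots> \<le> 1" using F sum_pmf_le_1[of "length ` F" \<pi>M] by simp
  finally show ?thesis .
qed

lemma product_prior_nonneg: "0 \<le> product_prior \<pi>M \<pi>K \<pi>T s"
  by (simp add: product_prior_eq path_weight_nonneg)

lemma product_prior_summable:
  assumes T: "set_pmf \<pi>T = {1..}"
  shows "product_prior \<pi>M \<pi>K \<pi>T summable_on switch_params"
    and "infsum (product_prior \<pi>M \<pi>K \<pi>T) switch_params \<le> 1"
proof -
  show "product_prior \<pi>M \<pi>K \<pi>T summable_on switch_params"
    using sum_product_prior_le_1[OF T]
    by (intro nonneg_bdd_above_summable_on product_prior_nonneg bdd_aboveI[of _ 1]) auto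
  then show "infsum (product_prior \<pi>M \<pi>K \<pi>T) switch_params \<le> 1"
    using sum_product_prior_le_1[OF T] by (intro infsum_le_finite_sums)
qed

lemma expert_mixture_product_prior:
  assumes "set_pmf \<pi>M = {1..}" "set_pmf \<pi>K = {1..}" "set_pmf \<pi>T = {1..}"
  shows "expert_mixture histogram (product_prior \<pi>M \<pi>K \<pi>T)"
proof
  show "\<exists>s\<in>switch_params. 0 < product_prior \<pi>M \<pi>K \<pi>T s"
  proof (intro bexI)
    show "[(0, 1)] \<in> switch_params" by (simp add: switch_params_def)
    show "0 < product_prior \<pi>M \<pi>K \<pi>T [(0, 1)]" using assms by (simp add: product_prior_def pmf_positive)
  qed
qed (use assms in \<open>auto intro: admissible_histogram product_prior_nonneg product_prior_summable\<close>)

section \<open>Doubling switch sequences\<close>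

text \<open>The number of bins doubles whenever the sample size has grown by the factor eight, so that it stays
  within a factor two of the cube root of the sample size. The first switch time must be \<open>0\<close>, not
  \<open>8 ^ 0\<close>.\<close>

definition doubling :: "nat \<Rightarrow> (nat \<times> nat) list" where
  "doubling m = map (\<lambda>i. (if i = 0 then 0 else 8 ^ i, 2 ^ i)) [0..<m]"

lemma doubling_nth: "i < m \<Longrightarrow> doubling m ! i = (if i = 0 then 0 else 8 ^ i, 2 ^ i)"
  by (simp add: doubling_def)

lemma doubling_in_switch_params:
  assumes "m \<ge> 1"
  shows "doubling m \<in> switch_params"
proof -
  have "sorted_wrt (<) (map fst (doubling m))"
    unfolding doubling_def by (auto simp: sorted_wrt_iff_nth_less)
  then show ?thesis using assms by (auto simp: switch_params_def doubling_def)
qed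

lemma length_doubling: "length (doubling m) = m"
  by (simp add: doubling_def)

text \<open>Stated in terms of \<open>n + 1\<close> to include \<open>n = 0\<close>, where a single bin is used as well.\<close>

lemma doubling_active:
  assumes n: "n < 8 ^ m" and m: "m \<ge> 1"
  obtains j where "snd (doubling m ! active_index (doubling m) n) = 2 ^ j"
    "8 ^ j \<le> n + 1" "n + 1 \<le> 8 ^ Suc j"
proof -
  define j where "j = (LEAST j. n < 8 ^ Suc j)"
  have ex: "n < 8 ^ Suc (m - 1)" using assms by simp
  have j1: "n < 8 ^ Suc j" unfolding j_def using ex by (rule LeastI[of "\<lambda>j. n < 8 ^ Suc j"])
  have jm: "j \<le> m - 1" unfolding j_def using ex by (rule Least_le[of "\<lambda>j. n < 8 ^ Suc j"])
  have j0: "8 ^ j \<le> n" if "j > 0"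
    using not_less_Least[of "j - 1" "\<lambda>j. n < 8 ^ Suc j"] that by (auto simp: j_def)
  have "active_index (doubling m) n = j"
  proof (intro active_index_eqI doubling_in_switch_params m)
    show "Suc j = length (doubling m) \<or> n < fst (doubling m ! Suc j)"
      using j1 jm m by (cases "Suc j = m") (auto simp: length_doubling doubling_nth)
  qed (use jm j0 m in \<open>auto simp: length_doubling doubling_nth\<close>)
  then have "snd (doubling m ! active_index (doubling m) n) = 2 ^ j"
    using jm m by (simp add: doubling_nth)
  moreover have "8 ^ j \<le> n + 1" using j0 by (cases "j = 0") auto
  moreover have "n + 1 \<le> 8 ^ Suc j" using j1 by simp
  ultimately show ?thesis by (rule that)
qed

text \<open>An asymptotic bound becomes a uniform one after enlarging the constant by the finitely many
  exceptional values; the summand \<open>1\<close> covers arguments where \<open>g\<close> vanishes.\<close>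

lemma neg_log_pmf_bound:
  fixes g :: "nat \<Rightarrow> real"
  assumes O: "(\<lambda>k. - log 2 (pmf p k)) \<in> O(\<lambda>k. g k)" and g: "\<And>k. k \<ge> 1 \<Longrightarrow> 0 \<le> g k"
  obtains B where "B \<ge> 0" "\<And>k. k \<ge> 1 \<Longrightarrow> - log 2 (pmf p k) \<le> B * (1 + g k)"
proof -
  from landau_o.bigE[OF O] obtain c where c: "c > 0"
    "eventually (\<lambda>k. norm (- log 2 (pmf p k)) \<le> c * norm (g k)) at_top" by blast
  then obtain N where N: "\<And>k. k \<ge> N \<Longrightarrow> \<bar>log 2 (pmf p k)\<bar> \<le> c * \<bar>g k\<bar>"
    unfolding eventually_at_top_linorder by auto
  define B where "B = c + (\<Sum>k<N. \<bar>log 2 (pmf p k)\<bar>)"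
  have B: "c \<le> B" "B \<ge> 0" using c by (auto simp: B_def sum_nonneg)
  show ?thesis
  proof (rule that[of B])
    fix k :: nat assume k: "k \<ge> 1"
    show "- log 2 (pmf p k) \<le> B * (1 + g k)"
    proof (cases "k \<ge> N")
      case True
      have "- log 2 (pmf p k) \<le> c * g k" using N[OF True] g[OF k] by auto
      also have "\<dots> \<le> B * (1 + g k)" using B c g[OF k] by (intro mult_mono) auto
      finally show ?thesis .
    next
      case False
      have "\<bar>log 2 (pmf p k)\<bar> \<le> (\<Sum>k<N. \<bar>log 2 (pmf p k)\<bar>)"
        using False by (intro member_le_sum) auto
      then have "- log 2 (pmf p k) \<le> B * 1" using c by (simp add: B_def)
      also have "\<dots> \<le> B * (1 + g k)" using B g[OF k] by (intro mult_left_mono) auto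
      finally show ?thesis .
    qed
  qed (rule B)
qed

text \<open>Each of the \<open>m\<close> switches has a time and a number of bins that are exponential in its index, so it
  costs \<open>O(m)\<close> bits.\<close>

lemma neg_log_prior_doubling:
  fixes \<pi>M \<pi>K \<pi>T :: "nat pmf"
  assumes M: "set_pmf \<pi>M = {1..}" and K: "set_pmf \<pi>K = {1..}" and T: "set_pmf \<pi>T = {1..}"
    and "(\<lambda>m. - log 2 (pmf \<pi>M m)) \<in> O(\<lambda>m. real m)"
    and "(\<lambda>k. - log 2 (pmf \<pi>K k)) \<in> O(\<lambda>k. log 2 (real k))"
    and "(\<lambda>t. - log 2 (pmf \<pi>T t)) \<in> O(\<lambda>t. log 2 (real t))"
  obtains B where "B \<ge> 0" "\<And>m. m \<ge> 1 \<Longrightarrow> - log 2 (product_prior \<pi>M \<pi>K \<pi>T (doubling m)) \<le> B * real m ^ 2"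
proof -
  obtain BM where BM: "BM \<ge> 0" "\<And>m. m \<ge> 1 \<Longrightarrow> - log 2 (pmf \<pi>M m) \<le> BM * (1 + real m)"
    by (rule neg_log_pmf_bound[OF assms(4)]) auto
  obtain BK where BK: "BK \<ge> 0" "\<And>m. m \<ge> 1 \<Longrightarrow> - log 2 (pmf \<pi>K m) \<le> BK * (1 + log 2 (real m))"
    by (rule neg_log_pmf_bound[OF assms(5)]) auto
  obtain BT where BT: "BT \<ge> 0" "\<And>m. m \<ge> 1 \<Longrightarrow> - log 2 (pmf \<pi>T m) \<le> BT * (1 + log 2 (real m))"
    by (rule neg_log_pmf_bound[OF assms(6)]) auto
  \<comment> \<open>The cost of the initial number of bins is charged like one more switch.\<close>
  define B where "B = 2 * BM + BK + 4 * BT"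
  define w where "w i = pmf_after \<pi>T (fst (doubling (Suc i) ! (i - 1))) (8 ^ i) * pmf \<pi>K (2 ^ i)" for i
  show ?thesis
  proof (rule that[of B])
    fix m :: nat assume m: "m \<ge> 1"
    have Kpos: "pmf \<pi>K (2 ^ i) > 0" for i using K by (simp add: pmf_positive)
    have Tpos: "pmf_after \<pi>T t' (8 ^ i) > 0" for i t'
      using T pmf_le_pmf_after[OF T, of "8 ^ i" t'] pmf_positive[of "8 ^ i" \<pi>T] by (simp add: less_le_trans)
    have logK: "- log 2 (pmf \<pi>K (2 ^ i)) \<le> BK * (1 + real i)" for i
      using BK(2)[of "2 ^ i"] by (simp add: log_nat_power)
    have log8: "log 2 8 = (3::real)" using log_pow_cancel[of 2 3] by simp
    have logT: "- log 2 (pmf_after \<pi>T t' (8 ^ i)) \<le> BT * (1 + 3 * real i)" for i t'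
    proof -
      have "log 2 (pmf \<pi>T (8 ^ i)) \<le> log 2 (pmf_after \<pi>T t' (8 ^ i))"
        using pmf_le_pmf_after[OF T, of "8 ^ i" t'] T by (intro log_mono) (auto simp: pmf_positive)
      with BT(2)[of "8 ^ i"] show ?thesis by (simp add: log_nat_power log8 mult.commute)
    qed
    have fstnth: "fst (doubling m ! (i - 1)) = fst (doubling (Suc i) ! (i - 1))" if "i \<in> {1..<m}" for i
      using that by (auto simp: doubling_nth)
    have "product_prior \<pi>M \<pi>K \<pi>T (doubling m) = pmf \<pi>M m * pmf \<pi>K (2 ^ 0) * (\<Prod>i\<in>{1..<m}. w i)"
      unfolding product_prior_def length_doubling using m fstnth
      by (auto simp: w_def doubling_nth intro!: prod.cong)
    moreover have wpos: "w i > 0" for i using Kpos Tpos by (simp add: w_def)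
    moreover have "pmf \<pi>M m > 0" using M m by (simp add: pmf_positive)
    ultimately have "log 2 (product_prior \<pi>M \<pi>K \<pi>T (doubling m))
        = log 2 (pmf \<pi>M m) + log 2 (pmf \<pi>K (2 ^ 0)) + log 2 (\<Prod>i\<in>{1..<m}. w i)"
      using Kpos[of 0] by (simp add: log_mult_pos prod_pos)
    also have "log 2 (\<Prod>i\<in>{1..<m}. w i) = (\<Sum>i\<in>{1..<m}. log 2 (w i))"
      using wpos by (simp add: log_def ln_prod less_imp_neq[THEN not_sym] sum_divide_distrib)
    finally have "- log 2 (product_prior \<pi>M \<pi>K \<pi>T (doubling m))
        = - log 2 (pmf \<pi>M m) + - log 2 (pmf \<pi>K (2 ^ 0)) + (\<Sum>i\<in>{1..<m}. - log 2 (w i))"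
      by (simp add: sum_negf)
    also have "\<dots> \<le> BM * (1 + real m) + BK * (1 + real 0) + (\<Sum>i\<in>{1..<m}. BK * real m + BT * (4 * real m))"
    proof (intro add_mono BM(2) m logK sum_mono)
      fix i assume i: "i \<in> {1..<m}"
      have "- log 2 (w i) = - log 2 (pmf_after \<pi>T (fst (doubling (Suc i) ! (i - 1))) (8 ^ i)) + - log 2 (pmf \<pi>K (2 ^ i))"
        using Kpos[of i] Tpos by (simp add: w_def log_mult_pos)
      also have "\<dots> \<le> BT * (1 + 3 * real i) + BK * (1 + real i)"
        by (intro add_mono logT logK)
      also have "\<dots> \<le> BT * (4 * real m) + BK * real m"
        using i BK(1) BT(1) by (intro add_mono mult_left_mono) auto
      finally show "- log 2 (w i) \<le> BK * real m + BT * (4 * real m)" by simp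
    qed
    also have "\<dots> = BM * (1 + real m) + BK + (real m - 1) * ((BK + 4 * BT) * real m)"
      using m by (simp add: algebra_simps)
    also have "\<dots> \<le> BM * (2 * real m ^ 2) + ((BK + 4 * BT) * real m) + (real m - 1) * ((BK + 4 * BT) * real m)"
    proof (intro add_mono mult_left_mono BM(1))
      have "1 * real m \<le> real m * real m" using m by (intro mult_right_mono) auto
      then show "1 + real m \<le> 2 * real m ^ 2" using m unfolding power2_eq_square by linarith
      show "BK \<le> (BK + 4 * BT) * real m"
        using m BK(1) BT(1) mult_mono[of BK "BK + 4 * BT" 1 "real m"] by auto
    qed (use m BK(1) BT(1) in auto)
    also have "\<dots> = B * real m ^ 2" by (simp add: B_def algebra_simps power2_eq_square)
    finally show "- log 2 (product_prior \<pi>M \<pi>K \<pi>T (doubling m)) \<le> B * real m ^ 2" .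
  qed (use BM BK BT in \<open>simp add: B_def\<close>)
qed

lemma product_prior_doubling_pos:
  assumes M: "set_pmf \<pi>M = {1..}" and K: "set_pmf \<pi>K = {1..}" and T: "set_pmf \<pi>T = {1..}" and m: "m \<ge> 1"
  shows "0 < product_prior \<pi>M \<pi>K \<pi>T (doubling m)"
proof -
  have "0 < pmf_after \<pi>T t' t" if "t \<ge> 1" for t t'
    using less_le_trans[OF _ pmf_le_pmf_after[OF T, of t t']] T that by (simp add: pmf_positive)
  then show ?thesis
    using M K m by (auto simp: product_prior_def length_doubling doubling_nth pmf_positive intro!: mult_pos_pos prod_pos)
qed

section \<open>Resampling a coordinate of an i.i.d. sequence\<close>

locale bounded_density =
  fixes f :: "real \<Rightarrow> real" and c0 c1 :: real
  assumes f_measurable [measurable]: "f \<in> borel_measurable unit_lborel"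
    and f_integral: "(\<integral>\<^sup>+x. ennreal (f x) \<partial>unit_lborel) = 1"
    and f_lower: "x \<in> {0..1} \<Longrightarrow> c0 \<le> f x" and f_upper: "x \<in> {0..1} \<Longrightarrow> f x \<le> c1"
    and c0_pos: "0 < c0"
begin

definition D :: "real measure" where "D = density unit_lborel (\<lambda>x. ennreal (f x))"

definition P :: "(nat \<Rightarrow> real) measure" where "P = (\<Pi>\<^sub>M i\<in>UNIV. D)"

lemma f_pos: "x \<in> {0..1} \<Longrightarrow> 0 < f x"
  using f_lower c0_pos by (meson less_le_trans)

lemma sets_D [measurable_cong, simp]: "sets D = sets unit_lborel" and space_D [simp]: "space D = {0..1}"
  by (simp_all add: D_def)

sublocale D: prob_space D
proof
  have "emeasure D (space D) = (\<integral>\<^sup>+x. ennreal (f x) \<partial>unit_lborel)"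
    unfolding space_D D_def
    by (subst emeasure_density) (auto intro!: nn_integral_cong sets_unit_lborel)
  then show "emeasure D (space D) = 1" by (simp add: f_integral)
qed

lemma sets_P [measurable_cong, simp]: "sets P = sets (seq_space UNIV)"
  unfolding P_def seq_space_def by (intro sets_PiM_cong) auto

lemma space_P: "space P = space (seq_space UNIV)"
  using sets_P by (rule sets_eq_imp_space_eq)

sublocale P: prob_space P
  unfolding P_def by (intro prob_space_PiM D.prob_space_axioms)

sublocale DP: pair_prob_space D P ..

lemma measurable_resample [measurable]:
  "(\<lambda>(y, \<omega>). fun_upd \<omega> n y) \<in> D \<Otimes>\<^sub>M P \<rightarrow>\<^sub>M seq_space UNIV"
proof -
  have "(\<lambda>z. fun_upd (snd z) n (fst z)) \<in> D \<Otimes>\<^sub>M P \<rightarrow>\<^sub>M (\<Pi>\<^sub>M i\<in>UNIV. D)"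
    by (rule measurable_fun_upd[where J = UNIV]) (auto simp: P_def[symmetric])
  then show ?thesis
    unfolding split_beta using sets_P unfolding P_def by (simp cong: measurable_cong_sets)
qed

text \<open>Replacing one coordinate by an independent copy does not change the law of the sequence. All
  uses of independence below go through this identity.\<close>

lemma distr_resample: "distr (D \<Otimes>\<^sub>M P) P (\<lambda>(y, \<omega>). fun_upd \<omega> n y) = P"
  using distr_pair_PiM_eq_PiM[of UNIV "\<lambda>_. D" n] D.prob_space_axioms by (simp add: P_def)

lemma measurable_resample_P [measurable]:
  "(\<lambda>(y, \<omega>). fun_upd \<omega> n y) \<in> D \<Otimes>\<^sub>M P \<rightarrow>\<^sub>M P"
  using measurable_resample[of n] by simp

lemma nn_integral_resample:
  assumes [measurable]: "g \<in> borel_measurable (seq_space UNIV)"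
  shows "(\<integral>\<^sup>+\<omega>. g \<omega> \<partial>P) = (\<integral>\<^sup>+\<omega>. \<integral>\<^sup>+y. g (fun_upd \<omega> n y) \<partial>D \<partial>P)"
proof -
  have "(\<integral>\<^sup>+\<omega>. g \<omega> \<partial>P) = (\<integral>\<^sup>+z. g (fun_upd (snd z) n (fst z)) \<partial>(D \<Otimes>\<^sub>M P))"
    by (subst distr_resample[of n, symmetric], subst nn_integral_distr) (auto simp: split_beta)
  also have "\<dots> = (\<integral>\<^sup>+\<omega>. \<integral>\<^sup>+y. g (fun_upd \<omega> n y) \<partial>D \<partial>P)"
    using measurable_compose[OF measurable_resample[of n] assms]
    by (subst DP.nn_integral_snd[symmetric]) (auto simp: split_beta)
  finally show ?thesis .
qed

lemma integral_resample:
  fixes g :: "(nat \<Rightarrow> real) \<Rightarrow> real"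
  assumes g [measurable]: "g \<in> borel_measurable (seq_space UNIV)"
    and bd: "\<And>\<omega>. \<omega> \<in> space P \<Longrightarrow> \<bar>g \<omega>\<bar> \<le> B"
  shows "integrable P (\<lambda>\<omega>. \<integral>y. g (fun_upd \<omega> n y) \<partial>D)"
    and "(\<integral>\<omega>. g \<omega> \<partial>P) = (\<integral>\<omega>. \<integral>y. g (fun_upd \<omega> n y) \<partial>D \<partial>P)"
proof -
  have m: "(\<lambda>(y, \<omega>). g (fun_upd \<omega> n y)) \<in> borel_measurable (D \<Otimes>\<^sub>M P)"
    using measurable_compose[OF measurable_resample[of n] g] by (simp add: split_beta)
  have int: "integrable (D \<Otimes>\<^sub>M P) (\<lambda>(y, \<omega>). g (fun_upd \<omega> n y))"
    using m measurable_space[OF measurable_resample_P[of n]]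
    by (intro DP.P.integrable_const_bound[of _ B]) (auto intro!: AE_I2 bd simp: split_beta)
  show "integrable P (\<lambda>\<omega>. \<integral>y. g (fun_upd \<omega> n y) \<partial>D)"
    using DP.integrable_snd[OF int] .
  have "(\<integral>\<omega>. g \<omega> \<partial>P) = (\<integral>z. g (fun_upd (snd z) n (fst z)) \<partial>(D \<Otimes>\<^sub>M P))"
    by (subst distr_resample[of n, symmetric], subst integral_distr) (auto simp: split_beta)
  also have "\<dots> = (\<integral>\<omega>. \<integral>y. g (fun_upd \<omega> n y) \<partial>D \<partial>P)"
    using DP.integral_snd[OF int, symmetric] by (simp add: case_prod_unfold)
  finally show "(\<integral>\<omega>. g \<omega> \<partial>P) = (\<integral>\<omega>. \<integral>y. g (fun_upd \<omega> n y) \<partial>D \<partial>P)" .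
qed

section \<open>The conditional distribution of the next outcome\<close>

lemma measurable_restrict_seq [measurable]:
  "(\<lambda>\<omega>. restrict \<omega> {..<n}) \<in> seq_space UNIV \<rightarrow>\<^sub>M seq_space {..<n}"
  unfolding seq_space_def by (rule measurable_restrict_subset) simp

lemma emeasure_past_future:
  assumes B[measurable]: "B \<in> sets (seq_space {..<n})" and A[measurable]: "A \<in> sets unit_lborel"
  shows "emeasure P {\<omega>\<in>space P. restrict \<omega> {..<n} \<in> B \<and> \<omega> n \<in> A} =
    (\<integral>\<^sup>+\<omega>. emeasure D A * indicator B (restrict \<omega> {..<n}) \<partial>P)"
proof -
  note [measurable] = measurable_seq_component[of n]
  let ?S = "{\<omega>\<in>space P. restrict \<omega> {..<n} \<in> B \<and> \<omega> n \<in> A}"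
  have S: "?S \<in> sets P" unfolding space_P sets_P by measurable
  have "emeasure P ?S = (\<integral>\<^sup>+\<omega>. indicator ?S \<omega> \<partial>P)" using S by simp
  also have "\<dots> = (\<integral>\<^sup>+\<omega>. \<integral>\<^sup>+y. indicator ?S (fun_upd \<omega> n y) \<partial>D \<partial>P)"
    using S by (intro nn_integral_resample) simp
  also have "\<dots> = (\<integral>\<^sup>+\<omega>. \<integral>\<^sup>+y. indicator B (restrict \<omega> {..<n}) * indicator A y \<partial>D \<partial>P)"
  proof (intro nn_integral_cong)
    fix \<omega> y assume "\<omega> \<in> space P" "y \<in> space D"
    then have "fun_upd \<omega> n y \<in> space P" by (auto simp: space_P space_seq_space)
    moreover have "restrict (fun_upd \<omega> n y) {..<n} = restrict \<omega> {..<n}" by (auto simp: restrict_def)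
    ultimately show "indicator ?S (fun_upd \<omega> n y) = (indicator B (restrict \<omega> {..<n}) * indicator A y :: ennreal)"
      by (auto simp: indicator_def)
  qed
  also have "\<dots> = (\<integral>\<^sup>+\<omega>. emeasure D A * indicator B (restrict \<omega> {..<n}) \<partial>P)"
  proof (intro nn_integral_cong)
    show "(\<integral>\<^sup>+y. indicator B (restrict \<omega> {..<n}) * indicator A y \<partial>D) = emeasure D A * indicator B (restrict \<omega> {..<n})" for \<omega>
      using A by (subst nn_integral_cmult) (auto simp: mult.commute intro!: borel_measurable_indicator)
  qed
  finally show ?thesis .
qed

text \<open>Independence makes the law of the next outcome a version of its conditional law.\<close>

lemma is_cond_distr_iid: "is_cond_distr P n (\<lambda>_. D)"
  unfolding is_cond_distr_def
proof (intro conjI ballI)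
  show "(\<lambda>_. D) \<in> seq_space {..<n} \<rightarrow>\<^sub>M prob_algebra unit_lborel"
    by (rule measurable_const) (simp add: space_prob_algebra D.prob_space_axioms)
qed (rule emeasure_past_future)

text \<open>A countable generator that is closed under intersections turns "almost surely equal on each set"
  into "almost surely equal as measures".\<close>

lemma sets_borel_rational_rays: "sets (borel :: real measure) = sigma_sets UNIV (greaterThan ` \<rat>)"
proof
  have "{x<..} \<in> sigma_sets UNIV (greaterThan ` \<rat>)" for x :: real
  proof -
    have "{x<..} = (\<Union>q\<in>{q \<in> \<rat>. x < q}. {q<..})"
      using Rats_dense_in_real by (fastforce intro: less_trans)
    moreover have "countable {q \<in> \<rat>. x < (q :: real)}"
      by (rule countable_subset[OF _ countable_rat]) auto
    ultimately show ?thesis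
      by (auto intro!: sigma_sets_UNION)
  qed
  then have "range greaterThan \<subseteq> sigma_sets UNIV (greaterThan ` (\<rat> :: real set))" by auto
  from sigma_sets_mono[OF this] show "sets borel \<subseteq> sigma_sets UNIV (greaterThan ` (\<rat> :: real set))"
    by (simp add: borel_Ioi)
  show "sigma_sets UNIV (greaterThan ` (\<rat> :: real set)) \<subseteq> sets borel"
    by (intro sets.sigma_sets_subset') auto
qed

lemma measure_eqI_rational_rays:
  assumes M: "prob_space M" "sets M = sets unit_lborel" and N: "prob_space N" "sets N = sets unit_lborel"
    and eq: "\<And>q. q \<in> \<rat> \<Longrightarrow> emeasure M ({q<..} \<inter> {0..1}) = emeasure N ({q<..} \<inter> {0..1})"
  shows "M = N"
proof -
  interpret M: prob_space M by fact
  interpret N: prob_space N by fact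
  have sp: "space M = {0..1}" "space N = {0..1}"
    using M(2) N(2) by (auto dest: sets_eq_imp_space_eq)
  have m: "(\<lambda>x. x) \<in> M \<rightarrow>\<^sub>M borel" "(\<lambda>x. x) \<in> N \<rightarrow>\<^sub>M borel"
    using measurable_unit_borel M(2) N(2) by (simp_all cong: measurable_cong_sets)
  have em: "emeasure (distr M borel (\<lambda>x. x)) A = emeasure M (A \<inter> {0..1})"
     "emeasure (distr N borel (\<lambda>x. x)) A = emeasure N (A \<inter> {0..1})" if "A \<in> sets borel" for A
    using that m sp by (auto simp: emeasure_distr)
  have "distr M borel (\<lambda>x. x) = distr N borel (\<lambda>x. x)"
  proof (rule measure_eqI_generator_eq_countable[where E = "greaterThan ` \<rat>" and \<Omega> = UNIV and A = "greaterThan ` \<rat>"])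
    have "{a<..} \<inter> {b<..} = {max a b<..}" "max a b \<in> \<rat>" if "a \<in> \<rat>" "b \<in> \<rat>" for a b :: real
      using that by (auto simp: max_def)
    then show "Int_stable (greaterThan ` (\<rat> :: real set))"
      unfolding Int_stable_def by blast
    show "\<Union> (greaterThan ` (\<rat> :: real set)) = UNIV" by (auto intro: Rats_no_bot_less)
    show "emeasure (distr M borel (\<lambda>x. x)) a \<noteq> \<infinity>" if "a \<in> greaterThan ` \<rat>" for a
      using that by (auto simp: em)
  qed (auto simp: em eq sets_borel_rational_rays countable_rat)
  note eq' = this
  show ?thesis
  proof (rule measure_eqI)
    fix A assume "A \<in> sets M"
    then have A: "A \<in> sets borel" "A \<subseteq> {0..1}"
      using M(2) by (auto simp: unit_lborel_def sets_restrict_space_iff)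
    then show "emeasure M A = emeasure N A"
      using em[OF A(1)] eq' by (simp add: Int_absorb2)
  qed (simp add: M N)
qed

text \<open>The chosen version of the conditional distribution agrees with the constant one on every fixed
  event almost surely, and countably many events determine a measure.\<close>

lemma cond_distr_iid: "AE \<omega> in P. cond_distr P n (restrict \<omega> {..<n}) = D"
proof -
  define K where "K = cond_distr P n"
  have K: "is_cond_distr P n K"
    unfolding K_def cond_distr_def using is_cond_distr_iid[of n] by (rule someI[of "is_cond_distr P n"])
  then have Km: "K \<in> seq_space {..<n} \<rightarrow>\<^sub>M prob_algebra unit_lborel"
    and Ke: "\<And>B A. B \<in> sets (seq_space {..<n}) \<Longrightarrow> A \<in> sets unit_lborel \<Longrightarrow>
        emeasure P {\<omega>\<in>space P. restrict \<omega> {..<n} \<in> B \<and> \<omega> n \<in> A} =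
        (\<integral>\<^sup>+\<omega>. emeasure (K (restrict \<omega> {..<n})) A * indicator B (restrict \<omega> {..<n}) \<partial>P)"
    by (auto simp: is_cond_distr_def)
  have AE1: "AE \<omega> in P. emeasure (K (restrict \<omega> {..<n})) A = emeasure D A" if A: "A \<in> sets unit_lborel" for A
  proof -
    \<comment> \<open>On the law of the past, both sides are densities with the same integral over every event.\<close>
    define P' where "P' = distr P (seq_space {..<n}) (\<lambda>\<omega>. restrict \<omega> {..<n})"
    interpret P': prob_space P' unfolding P'_def by (intro P.prob_space_distr) measurable
    have [measurable]: "(\<lambda>x. emeasure (K x) A) \<in> borel_measurable (seq_space {..<n})"
      using measurable_compose[OF measurable_prob_algebraD[OF Km] measurable_emeasure_subprob_algebra[OF A]] .
    have [measurable_cong]: "sets P' = sets (seq_space {..<n})" by (simp add: P'_def)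
    have "AE x in P'. emeasure (K x) A = emeasure D A"
    proof (rule P'.density_unique_finite_measure)
      fix B assume "B \<in> sets P'"
      then have B[measurable]: "B \<in> sets (seq_space {..<n})" by (simp add: P'_def)
      have "(\<integral>\<^sup>+x. emeasure (K x) A * indicator B x \<partial>P')
          = (\<integral>\<^sup>+\<omega>. emeasure (K (restrict \<omega> {..<n})) A * indicator B (restrict \<omega> {..<n}) \<partial>P)"
        unfolding P'_def by (subst nn_integral_distr) auto
      also have "\<dots> = (\<integral>\<^sup>+\<omega>. emeasure D A * indicator B (restrict \<omega> {..<n}) \<partial>P)"
        using Ke[OF B A] emeasure_past_future[OF B A] by simp
      also have "\<dots> = (\<integral>\<^sup>+x. emeasure D A * indicator B x \<partial>P')"
        unfolding P'_def by (subst nn_integral_distr) auto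
      finally show "(\<integral>\<^sup>+x. emeasure (K x) A * indicator B x \<partial>P') = (\<integral>\<^sup>+x. emeasure D A * indicator B x \<partial>P')" .
    qed auto
    then show ?thesis unfolding P'_def by (rule AE_distrD[rotated]) measurable
  qed
  have rays: "{q<..} \<inter> {0..1} \<in> sets unit_lborel" for q :: real
    by (intro sets_unit_lborel) auto
  have "AE \<omega> in P. \<forall>q\<in>\<rat>. emeasure (K (restrict \<omega> {..<n})) ({q<..} \<inter> {0..1}) = emeasure D ({q<..} \<inter> {0..1})"
    by (intro AE_ball_countable' AE1 rays countable_rat)
  then have "AE \<omega> in P. K (restrict \<omega> {..<n}) = D"
  proof (rule AE_mp, intro AE_I2 impI)
    fix \<omega> assume \<omega>: "\<omega> \<in> space P"
      and eq: "\<forall>q\<in>\<rat>. emeasure (K (restrict \<omega> {..<n})) ({q<..} \<inter> {0..1}) = emeasure D ({q<..} \<inter> {0..1})"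
    have "restrict \<omega> {..<n} \<in> space (seq_space {..<n})"
      using measurable_space[OF measurable_restrict_seq[of n]] \<omega> by (simp add: space_P)
    from measurable_space[OF Km this] have "prob_space (K (restrict \<omega> {..<n}))" "sets (K (restrict \<omega> {..<n})) = sets unit_lborel"
      by (auto simp: space_prob_algebra)
    with eq show "K (restrict \<omega> {..<n}) = D"
      by (intro measure_eqI_rational_rays D.prob_space_axioms sets_D) auto
  qed
  then show ?thesis by (simp add: K_def)
qed

section \<open>Risk as expected log-loss redundancy\<close>

lemma log_ratio_bound:
  assumes "0 < l" "l \<le> u" "l \<le> v" "u \<le> B" "v \<le> B" 
  shows "\<bar>log 2 (u / v)\<bar> \<le> log 2 (B / l)"
proof -
  have "log 2 (u / v) \<le> log 2 (B / l)" "log 2 (v / u) \<le> log 2 (B / l)"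
    using assms by (auto intro!: log_mono divide_pos_pos frac_le)
  moreover have "log 2 (v / u) = - log 2 (u / v)"
    using assms by (simp add: log_divide)
  ultimately show ?thesis by linarith
qed

text \<open>Both densities are bounded and bounded away from zero, so the finite case in the definition of the
  divergence applies, and the density of one measure with respect to the other is \<open>f / q\<close>.\<close>

lemma KL_div_density:
  assumes q[measurable]: "q \<in> borel_measurable unit_lborel"
    and l: "0 < l" "\<And>y. y \<in> {0..1} \<Longrightarrow> l \<le> q y" and u: "\<And>y. y \<in> {0..1} \<Longrightarrow> q y \<le> u"
  shows "KL_div D (density unit_lborel (\<lambda>y. ennreal (q y))) = ennreal (\<integral>y. log 2 (f y / q y) \<partial>D)"
    and "integrable D (\<lambda>y. log 2 (f y / q y))"
proof -
  let ?Q = "density unit_lborel (\<lambda>y. ennreal (q y))"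
  have qpos: "0 < q y" if "y \<in> {0..1}" for y using l that by (meson less_le_trans)
  interpret Q: finite_measure ?Q
  proof
    have "emeasure ?Q (space ?Q) = (\<integral>\<^sup>+y. ennreal (q y) \<partial>unit_lborel)"
      by (subst emeasure_density) (auto intro!: nn_integral_cong sets_unit_lborel)
    also have "\<dots> \<le> (\<integral>\<^sup>+y. ennreal u \<partial>unit_lborel)"
      using u by (intro nn_integral_mono) (auto intro: ennreal_leI)
    also have "\<dots> < \<infinity>" using U.emeasure_space_1 by (simp add: ennreal_mult_less_top)
    finally show "emeasure ?Q (space ?Q) \<noteq> \<infinity>" by simp
  qed
  have D_eq: "density ?Q (\<lambda>y. ennreal (f y / q y)) = D"
    unfolding D_def using qpos f_pos
    by (intro density_density_divide AE_I2) (auto simp: less_imp_le less_imp_neq[symmetric] )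
  have ac: "absolutely_continuous ?Q D"
    by (subst D_eq[symmetric], rule absolutely_continuousI_density) auto
  have fq[measurable]: "(\<lambda>y. ennreal (f y / q y)) \<in> borel_measurable ?Q" by measurable
  have "AE y in ?Q. ennreal (f y / q y) = RN_deriv ?Q D y"
    using fq D_eq by (rule Q.RN_deriv_unique)
  then have "AE y in D. ennreal (f y / q y) = RN_deriv ?Q D y"
    using absolutely_continuous_AE[OF _ ac] by (simp add: D_def)
  then have ae: "AE y in D. entropy_density 2 ?Q D y = log 2 (f y / q y)"
    by (rule AE_mp) (auto intro!: AE_I2 simp: entropy_density_def eq_commute[of "ennreal _"]
       less_imp_le qpos f_pos)
  have em: "entropy_density 2 ?Q D \<in> borel_measurable D"
    using measurable_entropy_density[of 2 ?Q D] by (simp add: D_def cong: measurable_cong_sets)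
  define B where "B = max u c1" 
  have "\<bar>log 2 (f y / q y)\<bar> \<le> log 2 (B / min l c0)" if "y \<in> {0..1}" for y
    using that l(1) l(2)[OF that] u[OF that] f_lower[OF that] f_upper[OF that] c0_pos
    by (intro log_ratio_bound) (auto simp: B_def)
  then show int: "integrable D (\<lambda>y. log 2 (f y / q y))"
    by (intro D.integrable_const_bound[of _ "log 2 (B / min l c0)"]) (auto intro!: AE_I2)
  then have "integrable D (entropy_density 2 ?Q D)"
    using ae em by (subst integrable_cong_AE[of _ _ "\<lambda>y. log 2 (f y / q y)"]) auto
  moreover have "KL_divergence 2 ?Q D = (\<integral>y. log 2 (f y / q y) \<partial>D)"
    unfolding KL_divergence_def using ae em by (intro integral_cong_AE) auto
  ultimately show "KL_div D ?Q = ennreal (\<integral>y. log 2 (f y / q y) \<partial>D)"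
    unfolding KL_div_def using ac by simp
qed

text \<open>Gibbs' inequality, from \<open>ln z \<le> z - 1\<close> at \<open>z = q / f\<close>. It is needed since the conversion to
  extended nonnegative reals would otherwise cut off negative divergences and spoil additivity.\<close>

lemma expected_log_ratio_nonneg:
  assumes q[measurable]: "q \<in> borel_measurable unit_lborel"
    and l: "0 < l" "\<And>y. y \<in> {0..1} \<Longrightarrow> l \<le> q y" and u: "\<And>y. y \<in> {0..1} \<Longrightarrow> q y \<le> u"
    and q1: "(\<integral>\<^sup>+y. ennreal (q y) \<partial>unit_lborel) = 1"
  shows "0 \<le> (\<integral>y. log 2 (f y / q y) \<partial>D)"
proof -
  have qpos: "0 < q y" if "y \<in> {0..1}" for y using l that by (meson less_le_trans)
  have nn: "(\<integral>\<^sup>+y. ennreal (q y / f y) \<partial>D) = 1"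
  proof -
    have "(\<integral>\<^sup>+y. ennreal (q y / f y) \<partial>D) = (\<integral>\<^sup>+y. ennreal (f y) * ennreal (q y / f y) \<partial>unit_lborel)"
      unfolding D_def by (intro nn_integral_density) auto
    also have "\<dots> = (\<integral>\<^sup>+y. ennreal (q y) \<partial>unit_lborel)"
    proof (rule nn_integral_cong)
      fix y assume "y \<in> space unit_lborel"
      then have "0 < f y" "0 < q y" using f_pos qpos by auto
      then show "ennreal (f y) * ennreal (q y / f y) = ennreal (q y)"
        by (simp flip: ennreal_mult)
    qed
    finally show ?thesis using q1 by simp
  qed
  have int: "integrable D (\<lambda>y. q y / f y)" "(\<integral>y. q y / f y \<partial>D) = 1"
  proof -
    have "AE y in D. 0 \<le> q y / f y" using qpos f_pos by (intro AE_I2) (auto simp: less_imp_le)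
    with nn show "integrable D (\<lambda>y. q y / f y)" "(\<integral>y. q y / f y \<partial>D) = 1"
      by (auto simp: integral_eq_nn_integral intro!: integrableI_nn_integral_finite[where x = 1])
  qed
  have "0 = (\<integral>y. (1 - q y / f y) / ln 2 \<partial>D)"
    using int D.prob_space by simp
  also have "\<dots> \<le> (\<integral>y. log 2 (f y / q y) \<partial>D)"
  proof (rule integral_mono)
    fix y assume "y \<in> space D"
    then have "0 < f y" "0 < q y" using f_pos qpos by auto
    then have "ln (q y / f y) \<le> q y / f y - 1" by (intro ln_le_minus_one) simp
    moreover have "ln (q y / f y) = - ln (f y / q y)"
      using \<open>0 < f y\<close> \<open>0 < q y\<close> by (simp add: ln_div)
    ultimately have "1 - q y / f y \<le> ln (f y / q y)" by linarith
    then show "(1 - q y / f y) / ln 2 \<le> log 2 (f y / q y)"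
      by (simp add: log_def divide_right_mono)
  qed (use int KL_div_density(2)[OF q l u] in auto)
  finally show ?thesis .
qed

text \<open>The risk in predicting outcome \<open>n + 1\<close>, written as an expectation over the sequence. As a real number
  it can be summed and telescoped.\<close>

definition redundancy :: "strategy \<Rightarrow> nat \<Rightarrow> real" where
  "redundancy q n = (\<integral>\<omega>. log 2 (f (\<omega> n) / q (map \<omega> [0..<n]) (\<omega> n)) \<partial>P)"

lemma log_loss_measurable:
  assumes [measurable]: "admissible q"
  shows "(\<lambda>\<omega>. log 2 (f (\<omega> n) / q (map \<omega> [0..<n]) (\<omega> n))) \<in> borel_measurable (seq_space UNIV)"
proof -
  have [measurable]: "(\<lambda>\<omega>. f (\<omega> n)) \<in> borel_measurable (seq_space UNIV)"
    using measurable_compose[OF measurable_seq_component f_measurable] .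
  show ?thesis by measurable
qed

lemma log_loss_bound:
  assumes q: "admissible q" and \<omega>: "\<omega> \<in> space P"
  shows "\<bar>log 2 (f (\<omega> n) / q (map \<omega> [0..<n]) (\<omega> n))\<bar>
    \<le> log 2 (max (real n + 1) c1 / min (1 / (real n + 1)) c0)"
proof -
  have "\<omega> n \<in> {0..1}" using \<omega> by (auto simp: space_P space_seq_space)
  then show ?thesis
    using admissible_lower[OF q, of "map \<omega> [0..<n]" "\<omega> n"] admissible_upper[OF q, of "map \<omega> [0..<n]" "\<omega> n"]
      f_lower[of "\<omega> n"] f_upper[of "\<omega> n"] c0_pos
    by (intro log_ratio_bound) (auto simp: add_pos_nonneg)
qed

lemma integrable_log_loss:
  assumes q: "admissible q"
  shows "integrable P (\<lambda>\<omega>. log 2 (f (\<omega> n) / q (map \<omega> [0..<n]) (\<omega> n)))"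
  using log_loss_measurable[OF q, of n] log_loss_bound[OF q]
  by (intro P.integrable_const_bound) (auto intro!: AE_I2)

lemma risk_eq_redundancy:
  assumes q: "admissible q"
  shows "risk (Suc n) P q = ennreal (redundancy q n)" and "0 \<le> redundancy q n"
proof -
  define H where "H = (\<lambda>\<omega>. \<integral>y. log 2 (f y / q (map \<omega> [0..<n]) y) \<partial>D)"
  have sec: "q (map \<omega> [0..<n]) \<in> borel_measurable unit_lborel"
    "(\<integral>\<^sup>+y. ennreal (q (map \<omega> [0..<n]) y) \<partial>unit_lborel) = 1"
    "\<And>y. 1 / (real n + 1) \<le> q (map \<omega> [0..<n]) y" "\<And>y. q (map \<omega> [0..<n]) y \<le> real n + 1"
    if "\<omega> \<in> space P" for \<omega>
  proof -
    have xs: "set (map \<omega> [0..<n]) \<subseteq> {0..1}" using that by (auto simp: space_P space_seq_space)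
    show "q (map \<omega> [0..<n]) \<in> borel_measurable unit_lborel"
      "(\<integral>\<^sup>+y. ennreal (q (map \<omega> [0..<n]) y) \<partial>unit_lborel) = 1"
      using admissible_measurable_section[OF q xs] admissible_integral[OF q xs] by simp_all
    show "\<And>y. 1 / (real n + 1) \<le> q (map \<omega> [0..<n]) y" "\<And>y. q (map \<omega> [0..<n]) y \<le> real n + 1"
      using admissible_lower[OF q, of "map \<omega> [0..<n]"] admissible_upper[OF q, of "map \<omega> [0..<n]"] by simp_all
  qed
  have l: "0 < 1 / (real n + 1)" by (simp add: add_nonneg_pos)
  have KL: "KL_div D (density unit_lborel (\<lambda>y. ennreal (q (map \<omega> [0..<n]) y))) = ennreal (H \<omega>)"
    if "\<omega> \<in> space P" for \<omega>
    unfolding H_def using sec[OF that] l by (intro KL_div_density(1)) auto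
  have H0: "0 \<le> H \<omega>" if "\<omega> \<in> space P" for \<omega>
    unfolding H_def using sec[OF that] l by (intro expected_log_ratio_nonneg) auto
  have int: "integrable P H" "redundancy q n = (\<integral>\<omega>. H \<omega> \<partial>P)"
    using integral_resample[OF log_loss_measurable[OF q] log_loss_bound[OF q], of n n]
    unfolding H_def redundancy_def map_upd_upt fun_upd_same by blast+
  have "risk (Suc n) P q = (\<integral>\<^sup>+\<omega>. ennreal (H \<omega>) \<partial>P)"
    unfolding risk_def
  proof (intro nn_integral_cong_AE)
    show "AE \<omega> in P. KL_div (cond_distr P (Suc n - 1) (restrict \<omega> {..<Suc n - 1}))
        (density unit_lborel (\<lambda>y. ennreal (q (map \<omega> [0..<Suc n - 1]) y))) = ennreal (H \<omega>)"
      using cond_distr_iid[of n] by (rule AE_mp) (auto intro!: AE_I2 KL)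
  qed
  also have "\<dots> = ennreal (\<integral>\<omega>. H \<omega> \<partial>P)"
    using int(1) H0 by (intro nn_integral_eq_integral AE_I2)
  finally show "risk (Suc n) P q = ennreal (redundancy q n)" using int(2) by simp
  show "0 \<le> redundancy q n" unfolding int(2) using H0 by (intro integral_nonneg_AE AE_I2)
qed

lemma sum_risk_eq:
  assumes q: "admissible q"
  shows "(\<Sum>i=1..n. risk i P q) = ennreal (\<Sum>i<n. redundancy q i)"
proof -
  have "(\<Sum>i=1..n. risk i P q) = (\<Sum>i<n. risk (Suc i) P q)"
    by (rule sum.reindex_bij_witness[of _ Suc "\<lambda>i. i - 1"]) auto
  then show ?thesis using risk_eq_redundancy[OF q] by (simp add: sum_ennreal)
qed

text \<open>The chain rule: log-losses add up to the log-loss of the joint density.\<close>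

lemma sum_log_loss:
  assumes q: "admissible q" and \<omega>: "\<omega> \<in> space P"
  shows "(\<Sum>i<n. log 2 (f (\<omega> i) / q (map \<omega> [0..<i]) (\<omega> i)))
    = log 2 (\<Prod>i<n. f (\<omega> i)) - log 2 (joint_density q (map \<omega> [0..<n]))"
proof (induction n)
  case (Suc n)
  have "0 < f (\<omega> n)" "0 < (\<Prod>i<n. f (\<omega> i))"
    using \<omega> f_pos by (auto simp: space_P space_seq_space intro!: prod_pos)
  with Suc joint_density_pos[OF q, of "map \<omega> [0..<n]"] admissible_pos[OF q, of "map \<omega> [0..<n]" "\<omega> n"]
  show ?case by (simp add: joint_density_snoc log_mult_pos log_divide)
qed simp

lemma sum_redundancy:
  assumes q: "admissible q"
  shows "(\<Sum>i<n. redundancy q i) = (\<integral>\<omega>. (\<Sum>i<n. log 2 (f (\<omega> i) / q (map \<omega> [0..<i]) (\<omega> i))) \<partial>P)"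
  unfolding redundancy_def using integrable_log_loss[OF q] by simp

text \<open>The mixture argument. A strategy that multiplicatively dominates another one pays at most the
  logarithm of the factor in cumulative redundancy.\<close>

lemma sum_redundancy_le:
  assumes q: "admissible q" and r: "admissible r" and c: "0 < c"
    and dom: "\<And>xs. c * joint_density r xs \<le> joint_density q xs"
  shows "(\<Sum>i<n. redundancy q i) \<le> - log 2 c + (\<Sum>i<n. redundancy r i)"
proof -
  have int: "integrable P (\<lambda>\<omega>. \<Sum>i<n. log 2 (f (\<omega> i) / s (map \<omega> [0..<i]) (\<omega> i)))" if "admissible s" for s
    using integrable_log_loss[OF that] by simp
  have "(\<Sum>i<n. redundancy q i) \<le> (\<integral>\<omega>. - log 2 c + (\<Sum>i<n. log 2 (f (\<omega> i) / r (map \<omega> [0..<i]) (\<omega> i))) \<partial>P)"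
    unfolding sum_redundancy[OF q]
  proof (rule integral_mono)
    fix \<omega> assume \<omega>: "\<omega> \<in> space P"
    let ?xs = "map \<omega> [0..<n]"
    have "log 2 c + log 2 (joint_density r ?xs) = log 2 (c * joint_density r ?xs)"
      using c joint_density_pos[OF r, of ?xs] by (simp add: log_mult_pos)
    also have "\<dots> \<le> log 2 (joint_density q ?xs)"
      using dom c joint_density_pos[OF r, of ?xs] by (intro log_mono) auto
    finally show "(\<Sum>i<n. log 2 (f (\<omega> i) / q (map \<omega> [0..<i]) (\<omega> i)))
        \<le> - log 2 c + (\<Sum>i<n. log 2 (f (\<omega> i) / r (map \<omega> [0..<i]) (\<omega> i)))"
      unfolding sum_log_loss[OF q \<omega>] sum_log_loss[OF r \<omega>] by linarith
  qed (use int q r in auto)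
  also have "\<dots> = - log 2 c + (\<Sum>i<n. redundancy r i)"
    using int[OF r] P.prob_space by (simp add: sum_redundancy[OF r] del: Bochner_Integration.integral_sum)
  finally show ?thesis .
qed

end

section \<open>Inverse moments of binomial counts\<close>

text \<open>The mean of \<open>\<phi>\<close> under the binomial distribution, by conditioning on the last of the \<open>n\<close> trials.
  This recursion is the one that resampling the last coordinate produces.\<close>

fun binomial_mean :: "real \<Rightarrow> nat \<Rightarrow> (nat \<Rightarrow> real) \<Rightarrow> real" where
  "binomial_mean p 0 \<phi> = \<phi> 0"
| "binomial_mean p (Suc n) \<phi> = p * binomial_mean p n (\<lambda>j. \<phi> (Suc j)) + (1 - p) * binomial_mean p n \<phi>"

lemma binomial_mean_add:
  "binomial_mean p n (\<lambda>j. \<phi> j + \<psi> j) = binomial_mean p n \<phi> + binomial_mean p n \<psi>"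
  by (induction n arbitrary: \<phi> \<psi>) (auto simp: algebra_simps)

lemma binomial_mean_mono:
  assumes "0 \<le> p" "p \<le> 1" "\<And>j. \<phi> j \<le> \<psi> j"
  shows "binomial_mean p n \<phi> \<le> binomial_mean p n \<psi>"
  using assms(3)
  by (induction n arbitrary: \<phi> \<psi>) (auto intro!: add_mono mult_left_mono simp: assms)

lemma binomial_mean_const: "binomial_mean p n (\<lambda>_. c) = c"
  by (induction n) (auto simp: algebra_simps)

lemma binomial_mean_nonneg:
  "0 \<le> p \<Longrightarrow> p \<le> 1 \<Longrightarrow> (\<And>j. 0 \<le> \<phi> j) \<Longrightarrow> 0 \<le> binomial_mean p n \<phi>"
  using binomial_mean_mono[of p "\<lambda>_. 0" \<phi> n] by (simp add: binomial_mean_const)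

text \<open>Size biasing: weighting a binomial count by its value amounts to forcing one of the \<open>n + 1\<close> trials to
  succeed.\<close>

lemma binomial_mean_size_bias:
  "binomial_mean p (Suc n) (\<lambda>j. real j * \<psi> j) = real (Suc n) * p * binomial_mean p n (\<lambda>j. \<psi> (Suc j))"
proof (induction n arbitrary: \<psi>)
  case (Suc n)
  have *: "(\<lambda>j. real (Suc j) * \<psi> (Suc j)) = (\<lambda>j. real j * \<psi> (Suc j) + \<psi> (Suc j))"
    by (simp add: algebra_simps)
  have "binomial_mean p (Suc (Suc n)) (\<lambda>j. real j * \<psi> j)
      = p * (binomial_mean p (Suc n) (\<lambda>j. real j * \<psi> (Suc j)) + binomial_mean p (Suc n) (\<lambda>j. \<psi> (Suc j)))
        + (1 - p) * binomial_mean p (Suc n) (\<lambda>j. real j * \<psi> j)"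
    by (subst binomial_mean.simps(2)) (simp only: * binomial_mean_add)
  also have "\<dots> = real (Suc n) * p * (p * binomial_mean p n (\<lambda>j. \<psi> (Suc (Suc j))) + (1 - p) * binomial_mean p n (\<lambda>j. \<psi> (Suc j)))
       + p * binomial_mean p (Suc n) (\<lambda>j. \<psi> (Suc j))"
    unfolding Suc.IH[of "\<lambda>j. \<psi> (Suc j)"] Suc.IH[of \<psi>] by (simp only: algebra_simps)
  also have "\<dots> = real (Suc (Suc n)) * p * binomial_mean p (Suc n) (\<lambda>j. \<psi> (Suc j))"
    by (simp add: algebra_simps)
  finally show ?case .
qed simp

text \<open>Size biasing at \<open>\<psi> j = 1 / j\<close>, where \<open>j * \<psi> j\<close> is at most one also for \<open>j = 0\<close> as \<open>0 / 0 = 0\<close>.\<close>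

lemma binomial_mean_inverse_le:
  assumes "0 < p" "p \<le> 1"
  shows "binomial_mean p n (\<lambda>j. 1 / (real j + 1)) \<le> 1 / ((real n + 1) * p)"
proof -
  have "real (Suc n) * p * binomial_mean p n (\<lambda>j. 1 / real (Suc j))
      = binomial_mean p (Suc n) (\<lambda>j. real j * (1 / real j))"
    by (rule binomial_mean_size_bias[symmetric])
  also have "\<dots> \<le> binomial_mean p (Suc n) (\<lambda>_. 1)"
    using assms by (intro binomial_mean_mono) auto
  also have "\<dots> = 1" by (rule binomial_mean_const)
  finally have "binomial_mean p n (\<lambda>j. 1 / (real j + 1)) * ((real n + 1) * p) \<le> 1"
    by (simp add: algebra_simps)
  then show ?thesis using assms by (subst pos_le_divide_eq) (auto simp: add_nonneg_pos)
qed

lemma measurable_count: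
  assumes A: "A \<in> sets unit_lborel"
  shows "(\<lambda>\<omega>. card {i \<in> {..<n}. \<omega> i \<in> A}) \<in> measurable (seq_space UNIV) (count_space UNIV)"
proof (rule measurable_card)
  fix i
  have "Measurable.pred (seq_space UNIV) (\<lambda>\<omega>. i < n \<and> \<omega> i \<in> A)"
    by (intro pred_intros_logic pred_sets2[OF A measurable_seq_component] measurable_const) simp
  then show "{\<omega> \<in> space (seq_space UNIV). i \<in> {i \<in> {..<n}. \<omega> i \<in> A}} \<in> sets (seq_space UNIV)"
    unfolding pred_def mem_Collect_eq lessThan_iff .
qed

context bounded_density
begin

lemma expectation_count:
  assumes A: "A \<in> sets unit_lborel" and \<phi>: "\<And>j. 0 \<le> \<phi> j"
  shows "(\<integral>\<^sup>+\<omega>. ennreal (\<phi> (card {i \<in> {..<n}. \<omega> i \<in> A})) \<partial>P) = ennreal (binomial_mean (D.prob A) n \<phi>)"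
  using \<phi>
proof (induction n arbitrary: \<phi>)
  case 0
  then show ?case by (simp add: P.emeasure_space_1)
next
  case (Suc n)
  let ?N = "\<lambda>\<omega>. card {i \<in> {..<n}. \<omega> i \<in> A}"
  have A'[measurable]: "A \<in> sets D" using A by simp
  note N[measurable] = measurable_count[OF A]
  have NP[measurable]: "?N \<in> measurable P (count_space UNIV)" unfolding measurable_cong_sets[OF sets_P refl] by (rule N)
  have "(\<integral>\<^sup>+\<omega>. ennreal (\<phi> (card {i \<in> {..<Suc n}. \<omega> i \<in> A})) \<partial>P)
     = (\<integral>\<^sup>+\<omega>. \<integral>\<^sup>+y. ennreal (\<phi> (card {i \<in> {..<Suc n}. fun_upd \<omega> n y i \<in> A})) \<partial>D \<partial>P)"
    using measurable_compose[OF N[of "Suc n"], of "\<lambda>c. ennreal (\<phi> c)" borel]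
    by (intro nn_integral_resample[where g = "\<lambda>\<omega>. ennreal (\<phi> (card {i \<in> {..<Suc n}. \<omega> i \<in> A}))"]) simp
  also have "\<dots> = (\<integral>\<^sup>+\<omega>. ennreal (D.prob A) * ennreal (\<phi> (Suc (?N \<omega>))) + ennreal (1 - D.prob A) * ennreal (\<phi> (?N \<omega>)) \<partial>P)"
  proof (rule nn_integral_cong)
    fix \<omega>
    have count: "card {i \<in> {..<Suc n}. fun_upd \<omega> n y i \<in> A} = (if y \<in> A then Suc (?N \<omega>) else ?N \<omega>)" for y
    proof -
      have "{i \<in> {..<Suc n}. fun_upd \<omega> n y i \<in> A} = (if y \<in> A then insert n {i \<in> {..<n}. \<omega> i \<in> A} else {i \<in> {..<n}. \<omega> i \<in> A})"
        by (auto simp: less_Suc_eq)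
      then show ?thesis by simp
    qed
    have "(\<integral>\<^sup>+y. ennreal (\<phi> (card {i \<in> {..<Suc n}. fun_upd \<omega> n y i \<in> A})) \<partial>D)
       = (\<integral>\<^sup>+y. ennreal (\<phi> (Suc (?N \<omega>))) * indicator A y + ennreal (\<phi> (?N \<omega>)) * indicator (space D - A) y \<partial>D)"
      unfolding count by (intro nn_integral_cong) (auto simp: indicator_def)
    also have "\<dots> = ennreal (\<phi> (Suc (?N \<omega>))) * emeasure D A + ennreal (\<phi> (?N \<omega>)) * emeasure D (space D - A)"
      using A' sets.compl_sets[OF A']
      by (subst nn_integral_add) (simp_all add: nn_integral_cmult_indicator del: space_D)
    also have "\<dots> = ennreal (D.prob A) * ennreal (\<phi> (Suc (?N \<omega>))) + ennreal (1 - D.prob A) * ennreal (\<phi> (?N \<omega>))"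
      using D.prob_compl[OF A'] by (simp add: D.emeasure_eq_measure mult.commute del: space_D)
    finally show "(\<integral>\<^sup>+y. ennreal (\<phi> (card {i \<in> {..<Suc n}. fun_upd \<omega> n y i \<in> A})) \<partial>D) = \<dots>" .
  qed
  also have "\<dots> = ennreal (D.prob A) * (\<integral>\<^sup>+\<omega>. ennreal (\<phi> (Suc (?N \<omega>))) \<partial>P)
      + ennreal (1 - D.prob A) * (\<integral>\<^sup>+\<omega>. ennreal (\<phi> (?N \<omega>)) \<partial>P)"
  proof -
    have "(\<lambda>\<omega>. ennreal (\<phi> (Suc (?N \<omega>)))) \<in> borel_measurable P" "(\<lambda>\<omega>. ennreal (\<phi> (?N \<omega>))) \<in> borel_measurable P"
      using measurable_compose[OF NP, of "\<lambda>c. ennreal (\<phi> (Suc c))" borel]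
        measurable_compose[OF NP, of "\<lambda>c. ennreal (\<phi> c)" borel] by simp_all
    then show ?thesis by (subst nn_integral_add) (auto simp: nn_integral_cmult)
  qed
  also have "\<dots> = ennreal (binomial_mean (D.prob A) (Suc n) \<phi>)"
    using Suc.IH[of \<phi>] Suc.IH[of "\<lambda>j. \<phi> (Suc j)"] Suc.prems D.prob_le_1[of A]
    by (simp add: binomial_mean_nonneg flip: ennreal_mult ennreal_plus)
  finally show ?case .
qed

lemma expected_inverse_count:
  assumes A: "A \<in> sets unit_lborel" and p: "0 < D.prob A"
  shows "(\<integral>\<^sup>+\<omega>. ennreal (1 / (real (card {i \<in> {..<n}. \<omega> i \<in> A}) + 1)) \<partial>P)
    \<le> ennreal (1 / ((real n + 1) * D.prob A))"
  using expectation_count[OF A, of "\<lambda>j. 1 / (real j + 1)" n] binomial_mean_inverse_le[OF p D.prob_le_1, of n]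
  by (simp add: ennreal_leI)

end

section \<open>One-step redundancy of histograms\<close>

locale smooth_density = bounded_density +
  fixes f' :: "real \<Rightarrow> real" and c2 :: real
  assumes f_deriv: "x \<in> {0..1} \<Longrightarrow> (f has_real_derivative f' x) (at x within {0..1})"
    and f'_bound: "x \<in> {0..1} \<Longrightarrow> \<bar>f' x\<bar> \<le> c2"
begin

lemma c2_nonneg: "0 \<le> c2"
  using f'_bound[of 0] by auto

lemma f_lipschitz: "x \<in> {0..1} \<Longrightarrow> y \<in> {0..1} \<Longrightarrow> \<bar>f x - f y\<bar> \<le> c2 * \<bar>x - y\<bar>"
  using field_differentiable_bound[of "{0..1}" f f' c2 x y] f_deriv f'_bound by auto

text \<open>The histogram density with the true bin probabilities, which is the limit of the estimator for
  fixed \<open>k\<close>.\<close>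

definition bin_average :: "nat \<Rightarrow> real \<Rightarrow> real" where
  "bin_average k y = real k * D.prob {x. same_bin k x y}"

lemma same_bin_set:
  assumes "y \<in> {0..1}" "k \<ge> 1"
  shows "{x. same_bin k x y} \<in> sets unit_lborel" "emeasure unit_lborel {x. same_bin k x y} = ennreal (1 / real k)"
    "{x. same_bin k x y} \<subseteq> {0..1}"
  using emeasure_same_bin[OF assms] by (auto simp: same_bin_sym[of k _ y] intro: sets_unit_lborel)

lemma bin_average_bounds:
  assumes y: "y \<in> {0..1}" and k: "k \<ge> 1" and a: "\<And>x. x \<in> {0..1} \<Longrightarrow> same_bin k x y \<Longrightarrow> a \<le> f x \<and> f x \<le> b"
    and ab: "0 \<le> a" "0 \<le> b"
  shows "a \<le> bin_average k y" "bin_average k y \<le> b"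
proof -
  let ?B = "{x. same_bin k x y}"
  note B = same_bin_set[OF y k]
  have eq: "emeasure D ?B = (\<integral>\<^sup>+x. ennreal (f x) * indicator ?B x \<partial>unit_lborel)"
    unfolding D_def using B by (intro emeasure_density) auto
  have c: "(\<integral>\<^sup>+x. ennreal c * indicator ?B x \<partial>unit_lborel) = ennreal (c / real k)" if "0 \<le> c" for c
    using B that by (simp add: nn_integral_cmult_indicator flip: ennreal_mult)
  have "ennreal (a / real k) \<le> emeasure D ?B"
    unfolding eq c[OF ab(1), symmetric] using a by (intro nn_integral_mono) (auto simp: indicator_def intro: ennreal_leI)
  moreover have "emeasure D ?B \<le> ennreal (b / real k)"
    unfolding eq c[OF ab(2), symmetric] using a by (intro nn_integral_mono) (auto simp: indicator_def intro: ennreal_leI)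
  ultimately have "a / real k \<le> D.prob ?B" "D.prob ?B \<le> b / real k"
    using ab by (auto simp: D.emeasure_eq_measure)
  then show "a \<le> bin_average k y" "bin_average k y \<le> b"
    using k by (simp_all add: bin_average_def field_simps)
qed

lemma bin_average_ge: "y \<in> {0..1} \<Longrightarrow> k \<ge> 1 \<Longrightarrow> c0 \<le> bin_average k y"
  using f_lower f_upper c0_pos less_imp_le[OF less_le_trans[OF f_pos[of 0] f_upper[of 0]]] by (intro bin_average_bounds(1)[of y k c0 c1]) auto

text \<open>On a bin of length \<open>1 / k\<close> the density varies by at most \<open>c2 / k\<close>, and so does its average.\<close>

lemma bin_average_close:
  assumes y: "y \<in> {0..1}" and k: "k \<ge> 1"
  shows "\<bar>f y - bin_average k y\<bar> \<le> c2 / real k"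
proof -
  have near: "f y - c2 / real k \<le> f x \<and> f x \<le> f y + c2 / real k" if "x \<in> {0..1}" "same_bin k x y" for x
  proof -
    have "\<bar>f x - f y\<bar> \<le> c2 * (1 / real k)"
      using f_lipschitz[OF that(1) y] same_bin_dist[OF that(2)] c2_nonneg mult_left_mono order_trans by blast
    then show ?thesis by auto
  qed
  have "max 0 (f y - c2 / real k) \<le> bin_average k y" "bin_average k y \<le> f y + c2 / real k"
    using near f_pos f_pos[OF y] c2_nonneg
    by (intro bin_average_bounds[OF y k, of _ "f y + c2 / real k"] bin_average_bounds[OF y k, of "max 0 (f y - c2 / real k)"];
        auto simp: less_imp_le)+
  then show ?thesis by auto
qed

lemma sets_same_bin_pair: "{z \<in> space (unit_lborel \<Otimes>\<^sub>M D). same_bin k (snd z) (fst z)} \<in> sets (unit_lborel \<Otimes>\<^sub>M D)"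
proof -
  have "(\<lambda>x. x) \<in> D \<rightarrow>\<^sub>M (borel :: real measure)"
    using measurable_unit_borel by (simp cong: measurable_cong_sets)
  then have "(\<lambda>z. (snd z, fst z)) \<in> unit_lborel \<Otimes>\<^sub>M D \<rightarrow>\<^sub>M (borel \<Otimes>\<^sub>M borel :: (real \<times> real) measure)"
    by (intro measurable_Pair measurable_compose[OF measurable_fst measurable_unit_borel] measurable_compose[OF measurable_snd])
  from measurable_compose[OF this same_bin_measurable[of k]] show ?thesis by (simp add: pred_def)
qed

lemma bin_average_measurable:
  assumes k: "k \<ge> 1"
  shows "bin_average k \<in> borel_measurable unit_lborel"
proof -
  have "(\<lambda>y. emeasure D {x \<in> space D. same_bin k x y}) \<in> borel_measurable unit_lborel"
  proof (rule D.measurable_emeasure)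
    have "{z \<in> space (unit_lborel \<Otimes>\<^sub>M D). snd z \<in> {x \<in> space D. same_bin k x (fst z)}}
       = {z \<in> space (unit_lborel \<Otimes>\<^sub>M D). same_bin k (snd z) (fst z)}"
      by (auto simp: space_pair_measure)
    then show "{z \<in> space (unit_lborel \<Otimes>\<^sub>M D). snd z \<in> {x \<in> space D. same_bin k x (fst z)}} \<in> sets (unit_lborel \<Otimes>\<^sub>M D)"
      using sets_same_bin_pair by simp
  qed auto
  then have "(\<lambda>y. real k * enn2real (emeasure D {x \<in> space D. same_bin k x y})) \<in> borel_measurable unit_lborel"
    by measurable
  moreover have "real k * enn2real (emeasure D {x \<in> space D. same_bin k x y}) = bin_average k y" if "y \<in> space unit_lborel" for y
  proof -
    have "{x \<in> space D. same_bin k x y} = {x. same_bin k x y}" using same_bin_set(3)[of y k] that k by auto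
    then show ?thesis by (simp add: bin_average_def measure_def)
  qed
  ultimately show ?thesis by (subst (asm) measurable_cong) auto
qed

text \<open>Exchanging the order of integration replaces the law of the bins under \<open>D\<close> by their length, so that no
  sum over bins is needed.\<close>

lemma nn_integral_bin_average:
  assumes k: "k \<ge> 1"
  shows "(\<integral>\<^sup>+y. ennreal (bin_average k y) \<partial>unit_lborel) = 1"
proof -
  interpret UD: pair_sigma_finite unit_lborel D ..
  let ?I = "\<lambda>x y. indicator {z \<in> space (unit_lborel \<Otimes>\<^sub>M D). same_bin k (snd z) (fst z)} (y, x) :: ennreal"
  have "(\<integral>\<^sup>+y. ennreal (bin_average k y) \<partial>unit_lborel) = (\<integral>\<^sup>+y. \<integral>\<^sup>+x. ennreal (real k) * ?I x y \<partial>D \<partial>unit_lborel)"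
  proof (rule nn_integral_cong)
    fix y assume "y \<in> space unit_lborel"
    then have y: "y \<in> {0..1}" by simp
    have B: "{x. same_bin k x y} \<in> sets D" using same_bin_set(1)[OF y k] by simp
    have "(\<integral>\<^sup>+x. ennreal (real k) * ?I x y \<partial>D) = (\<integral>\<^sup>+x. ennreal (real k) * indicator {x. same_bin k x y} x \<partial>D)"
      using y by (intro nn_integral_cong) (auto simp: indicator_def space_pair_measure)
    also have "\<dots> = ennreal (bin_average k y)"
      using B by (simp add: nn_integral_cmult_indicator bin_average_def D.emeasure_eq_measure ennreal_mult)
    finally show "ennreal (bin_average k y) = (\<integral>\<^sup>+x. ennreal (real k) * ?I x y \<partial>D)" by simp
  qed
  also have "\<dots> = (\<integral>\<^sup>+x. \<integral>\<^sup>+y. ennreal (real k) * ?I x y \<partial>unit_lborel \<partial>D)"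
  proof (rule UD.Fubini'[symmetric])
    show "(\<lambda>(y, x). ennreal (real k) * ?I x y) \<in> borel_measurable (unit_lborel \<Otimes>\<^sub>M D)"
      using sets_same_bin_pair[of k] by (simp add: split_beta)
  qed
  also have "\<dots> = (\<integral>\<^sup>+x. 1 \<partial>D)"
  proof (rule nn_integral_cong)
    fix x assume "x \<in> space D"
    then have x: "x \<in> {0..1}" by simp
    have B: "{y. same_bin k x y} \<in> sets unit_lborel" "emeasure unit_lborel {y. same_bin k x y} = ennreal (1 / real k)"
      using emeasure_same_bin[OF x k] by (auto intro: sets_unit_lborel)
    have "(\<integral>\<^sup>+y. ennreal (real k) * ?I x y \<partial>unit_lborel) = (\<integral>\<^sup>+y. ennreal (real k) * indicator {y. same_bin k x y} y \<partial>unit_lborel)"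
      using x by (intro nn_integral_cong) (auto simp: indicator_def space_pair_measure)
    also have "\<dots> = 1"
      using B k by (simp add: nn_integral_cmult_indicator flip: ennreal_mult)
    finally show "(\<integral>\<^sup>+y. ennreal (real k) * ?I x y \<partial>unit_lborel) = 1" .
  qed
  also have "\<dots> = 1" using D.emeasure_space_1 by (simp del: space_D)
  finally show ?thesis .
qed

text \<open>The identity \<open>f\<^sup>2 / g = 2 f - g + (f - g)\<^sup>2 / g\<close> isolates the approximation error: the first two terms
  integrate to one as both \<open>f\<close> and the bin average \<open>g\<close> are probability densities.\<close>

lemma nn_integral_chi_square:
  assumes k: "k \<ge> 1"
  shows "(\<integral>\<^sup>+y. ennreal (f y ^ 2 / bin_average k y) \<partial>unit_lborel) \<le> ennreal (1 + c2\<^sup>2 / (c0 * real k ^ 2))"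
proof -
  note [measurable] = bin_average_measurable[OF k]
  let ?C = "c2\<^sup>2 / (c0 * real k ^ 2)"
  have C: "0 \<le> ?C" using c0_pos by simp
  have ptw: "f y ^ 2 / bin_average k y + bin_average k y \<le> 2 * f y + ?C" if y: "y \<in> {0..1}" for y
  proof -
    let ?g = "bin_average k y"
    have g: "0 < ?g" "c0 \<le> ?g" using bin_average_ge[OF y k] c0_pos by auto
    have "f y ^ 2 / ?g + ?g = 2 * f y + (f y - ?g)\<^sup>2 / ?g"
      using g by (simp add: field_simps power2_eq_square)
    also have "(f y - ?g)\<^sup>2 / ?g \<le> (c2 / real k)\<^sup>2 / c0"
    proof (rule frac_le)
      show "(f y - ?g)\<^sup>2 \<le> (c2 / real k)\<^sup>2"
        using bin_average_close[OF y k] by (metis abs_ge_zero power2_abs power_mono)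
    qed (use g c0_pos in auto)
    also have "(c2 / real k)\<^sup>2 / c0 = ?C" by (simp add: power_divide mult.commute)
    finally show ?thesis by simp
  qed
  have "(\<integral>\<^sup>+y. ennreal (f y ^ 2 / bin_average k y) \<partial>unit_lborel) + 1
      = (\<integral>\<^sup>+y. ennreal (f y ^ 2 / bin_average k y) + ennreal (bin_average k y) \<partial>unit_lborel)"
    using nn_integral_bin_average[OF k] by (subst nn_integral_add) auto
  also have "\<dots> \<le> (\<integral>\<^sup>+y. 2 * ennreal (f y) + ennreal ?C \<partial>unit_lborel)"
  proof (rule nn_integral_mono)
    fix y assume "y \<in> space unit_lborel"
    then have y: "y \<in> {0..1}" by simp
    have "0 \<le> f y ^ 2 / bin_average k y" "0 \<le> bin_average k y" "0 \<le> f y"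
      using bin_average_ge[OF y k] c0_pos f_pos[OF y] by (auto intro!: divide_nonneg_nonneg)
    then have "ennreal (f y ^ 2 / bin_average k y) + ennreal (bin_average k y) = ennreal (f y ^ 2 / bin_average k y + bin_average k y)"
      by (simp only: ennreal_plus)
    also have "\<dots> \<le> ennreal (2 * f y + ?C)" by (intro ennreal_leI ptw y)
    also have "\<dots> = 2 * ennreal (f y) + ennreal ?C"
      using \<open>0 \<le> f y\<close> C by (simp add: ennreal_mult)
    finally show "ennreal (f y ^ 2 / bin_average k y) + ennreal (bin_average k y) \<le> 2 * ennreal (f y) + ennreal ?C" .
  qed
  also have "\<dots> = 2 + ennreal ?C"
    using f_integral U.emeasure_space_1 by (subst nn_integral_add) (auto simp: nn_integral_cmult)
  also have "\<dots> = ennreal (1 + ?C) + 1"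
    using C by (simp add: add_ac flip: ennreal_1 ennreal_numeral ennreal_plus)
  finally show ?thesis
    by (simp add: ennreal_add_left_cancel_le add.commute[of _ 1])
qed

text \<open>For a fixed next outcome \<open>y\<close>, the expectation over the past of the inverse prediction involves only the
  inverse of the count in the bin of \<open>y\<close>. The factor \<open>(n + k) / (n + 1)\<close> is the price of estimating the
  bin probabilities; integrating over \<open>y\<close> leaves the approximation error.\<close>

lemma nn_integral_ratio_histogram:
  assumes k: "k \<ge> 1"
  shows "(\<integral>\<^sup>+\<omega>. ennreal (f (\<omega> n) / histogram k (map \<omega> [0..<n]) (\<omega> n)) \<partial>P)
    \<le> ennreal ((real n + real k) / (real n + 1) * (1 + c2\<^sup>2 / (c0 * real k ^ 2)))"
proof -
  note [measurable] = bin_average_measurable[OF k]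
  let ?c = "(real n + real k) / (real n + 1)"
  have c: "0 \<le> ?c" by simp
  have fm: "(\<lambda>\<omega>. f (\<omega> n)) \<in> borel_measurable (seq_space UNIV)"
    using measurable_compose[OF measurable_seq_component f_measurable] .
  have gm: "(\<lambda>\<omega>. ennreal (f (\<omega> n) / histogram k (map \<omega> [0..<n]) (\<omega> n))) \<in> borel_measurable (seq_space UNIV)"
    using fm admissible_measurable[OF admissible_histogram[OF k], of n] by measurable
  have "(\<integral>\<^sup>+\<omega>. ennreal (f (\<omega> n) / histogram k (map \<omega> [0..<n]) (\<omega> n)) \<partial>P)
     = (\<integral>\<^sup>+\<omega>. \<integral>\<^sup>+y. ennreal (f y / histogram k (map \<omega> [0..<n]) y) \<partial>D \<partial>P)"
    unfolding nn_integral_resample[OF gm, of n] map_upd_upt fun_upd_same ..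
  also have "\<dots> = (\<integral>\<^sup>+y. \<integral>\<^sup>+\<omega>. ennreal (f y / histogram k (map \<omega> [0..<n]) y) \<partial>P \<partial>D)"
  proof (rule DP.Fubini')
    show "(\<lambda>(y, \<omega>). ennreal (f y / histogram k (map \<omega> [0..<n]) y)) \<in> borel_measurable (D \<Otimes>\<^sub>M P)"
      using measurable_compose[OF measurable_resample[of n] gm] unfolding split_beta map_upd_upt fun_upd_same .
  qed
  also have "\<dots> \<le> (\<integral>\<^sup>+y. ennreal (?c * (f y / bin_average k y)) \<partial>D)"
  proof (rule nn_integral_mono)
    fix y assume "y \<in> space D"
    then have y: "y \<in> {0..1}" by simp
    let ?B = "{x. same_bin k x y}"
    have fy: "0 \<le> f y" using f_pos[OF y] by simp
    have p: "0 < D.prob ?B"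
      using bin_average_ge[OF y k] c0_pos k by (auto simp: bin_average_def zero_less_mult_iff dest: less_le_trans)
    \<comment> \<open>Only the count depends on the past, so the remaining factors leave the expectation.\<close>
    have "f y / histogram k (map \<omega> [0..<n]) y
        = (f y * (real n + real k) / real k) * (1 / (real (card {i \<in> {..<n}. \<omega> i \<in> ?B}) + 1))" for \<omega>
    proof -
      have "real (card {i \<in> {..<n}. \<omega> i \<in> ?B}) = real (length (filter (\<lambda>x. same_bin k x y) (map \<omega> [0..<n])))"
        unfolding real_length_filter_map_upt by (simp add: Int_def)
      then show ?thesis by (simp add: histogram_def)
    qed
    then have "(\<integral>\<^sup>+\<omega>. ennreal (f y / histogram k (map \<omega> [0..<n]) y) \<partial>P)
       = (\<integral>\<^sup>+\<omega>. ennreal (f y * (real n + real k) / real k) * ennreal (1 / (real (card {i \<in> {..<n}. \<omega> i \<in> ?B}) + 1)) \<partial>P)"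
      using fy by (intro nn_integral_cong) (simp only:, subst ennreal_mult, auto)
    also have "\<dots> = ennreal (f y * (real n + real k) / real k) * (\<integral>\<^sup>+\<omega>. ennreal (1 / (real (card {i \<in> {..<n}. \<omega> i \<in> ?B}) + 1)) \<partial>P)"
    proof (rule nn_integral_cmult)
      show "(\<lambda>\<omega>. ennreal (1 / (real (card {i \<in> {..<n}. \<omega> i \<in> ?B}) + 1))) \<in> borel_measurable P"
        using measurable_compose[OF measurable_count[OF same_bin_set(1)[OF y k]], of "\<lambda>c. ennreal (1 / (real c + 1))" borel n]
        unfolding measurable_cong_sets[OF sets_P refl] by simp
    qed
    also have "\<dots> \<le> ennreal (f y * (real n + real k) / real k) * ennreal (1 / ((real n + 1) * D.prob ?B))"
      by (intro mult_left_mono expected_inverse_count same_bin_set(1) y k p) simp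
    also have "\<dots> = ennreal (?c * (f y / bin_average k y))"
      using fy p by (simp add: bin_average_def ac_simps flip: ennreal_mult)
    finally show "(\<integral>\<^sup>+\<omega>. ennreal (f y / histogram k (map \<omega> [0..<n]) y) \<partial>P) \<le> ennreal (?c * (f y / bin_average k y))" .
  qed
  also have "\<dots> = (\<integral>\<^sup>+y. ennreal (f y) * ennreal (?c * (f y / bin_average k y)) \<partial>unit_lborel)"
    unfolding D_def by (intro nn_integral_density) auto
  also have "\<dots> = (\<integral>\<^sup>+y. ennreal ?c * ennreal (f y ^ 2 / bin_average k y) \<partial>unit_lborel)"
  proof (rule nn_integral_cong)
    fix y assume "y \<in> space unit_lborel"
    then have y: "y \<in> {0..1}" by simp
    have "0 \<le> bin_average k y" "0 \<le> f y" using bin_average_ge[OF y k] c0_pos f_pos[OF y] by auto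
    then show "ennreal (f y) * ennreal (?c * (f y / bin_average k y)) = ennreal ?c * ennreal (f y ^ 2 / bin_average k y)"
      by (simp add: power2_eq_square ac_simps flip: ennreal_mult)
  qed
  also have "\<dots> = ennreal ?c * (\<integral>\<^sup>+y. ennreal (f y ^ 2 / bin_average k y) \<partial>unit_lborel)"
    by (rule nn_integral_cmult) measurable
  also have "\<dots> \<le> ennreal ?c * ennreal (1 + c2\<^sup>2 / (c0 * real k ^ 2))"
    by (intro mult_left_mono nn_integral_chi_square k) simp
  also have "\<dots> = ennreal (?c * (1 + c2\<^sup>2 / (c0 * real k ^ 2)))"
    using c by (rule ennreal_mult'[symmetric])
  finally show ?thesis .
qed

text \<open>By \<open>ln z \<le> z - 1\<close> the logarithm of the likelihood ratio is bounded by the ratio itself. The estimation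
  error is \<open>O(k / n)\<close> and the approximation error \<open>O(1 / k\<^sup>2)\<close>.\<close>

lemma redundancy_histogram_le:
  assumes k: "k \<ge> 1"
  shows "redundancy (histogram k) n
    \<le> ((real n + real k) / (real n + 1) * (1 + c2\<^sup>2 / (c0 * real k ^ 2)) - 1) / ln 2"
proof -
  let ?R = "(real n + real k) / (real n + 1) * (1 + c2\<^sup>2 / (c0 * real k ^ 2))"
  let ?h = "\<lambda>\<omega>. histogram k (map \<omega> [0..<n]) (\<omega> n)"
  let ?r = "\<lambda>\<omega>. f (\<omega> n) / ?h \<omega>"
  note adm = admissible_histogram[OF k]
  have fm: "(\<lambda>\<omega>. f (\<omega> n)) \<in> borel_measurable (seq_space UNIV)"
    using measurable_compose[OF measurable_seq_component f_measurable] .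
  have rm: "?r \<in> borel_measurable P"
    using fm admissible_measurable[OF adm, of n] by measurable
  have pos: "0 < ?r \<omega>" if "\<omega> \<in> space P" for \<omega>
    using that f_pos admissible_pos[OF adm] by (auto simp: space_P space_seq_space)
  have R: "0 \<le> ?R" using c0_pos by (intro mult_nonneg_nonneg) auto
  have fin: "(\<integral>\<^sup>+\<omega>. ennreal (?r \<omega>) \<partial>P) < \<infinity>"
    using nn_integral_ratio_histogram[OF k, of n] by (auto intro: le_less_trans)
  have int: "integrable P ?r"
    using rm fin pos by (intro integrableI_nonneg) (auto intro!: AE_I2 less_imp_le)
  have "(\<integral>\<omega>. ?r \<omega> \<partial>P) = enn2real (\<integral>\<^sup>+\<omega>. ennreal (?r \<omega>) \<partial>P)"
    using rm pos by (intro integral_eq_nn_integral) (auto intro!: AE_I2 less_imp_le)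
  also have "\<dots> \<le> ?R"
    using nn_integral_ratio_histogram[OF k, of n] R by (intro enn2real_leI)
  finally have le: "(\<integral>\<omega>. ?r \<omega> \<partial>P) \<le> ?R" .
  have "redundancy (histogram k) n \<le> (\<integral>\<omega>. (?r \<omega> - 1) / ln 2 \<partial>P)"
    unfolding redundancy_def
  proof (rule integral_mono[OF integrable_log_loss[OF adm]])
    fix \<omega> assume "\<omega> \<in> space P"
    then have "ln (?r \<omega>) \<le> ?r \<omega> - 1" by (intro ln_le_minus_one pos)
    then show "log 2 (?r \<omega>) \<le> (?r \<omega> - 1) / ln 2" by (simp add: log_def divide_right_mono)
  qed (use int in auto)
  also have "\<dots> = ((\<integral>\<omega>. ?r \<omega> \<partial>P) - 1) / ln 2"
    using int P.prob_space by simp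
  also have "\<dots> \<le> (?R - 1) / ln 2" using le by (intro divide_right_mono) auto
  finally show ?thesis .
qed

end


section \<open>Cumulative risk\<close>

text \<open>A telescoping sum: with \<open>a\<close> and \<open>b\<close> the cube roots of \<open>n + 1\<close> and \<open>n\<close>, one has
  \<open>1 = a\<^sup>3 - b\<^sup>3 \<le> 3 a\<^sup>2 (a - b)\<close>.\<close>

lemma sum_powr_le: "(\<Sum>i<n. (real i + 1) powr (- 2 / 3)) \<le> 3 * real n powr (1 / 3)"
proof (induction n)
  case (Suc n)
  define a where "a = (real n + 1) powr (1 / 3)"
  define b where "b = real n powr (1 / 3)"
  have ab: "0 < a" "0 \<le> b" "b \<le> a" by (auto simp: a_def b_def intro!: powr_mono2)
  have a3: "a ^ 3 = real n + 1" by (simp add: a_def powr_powr flip: powr_realpow' powr_numeral)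
  have b3: "b ^ 3 = real n" by (cases "n = 0") (simp_all add: b_def powr_powr flip: powr_realpow' powr_numeral)
  have a2: "(real n + 1) powr (- 2 / 3) = 1 / a ^ 2"
    by (simp add: a_def powr_powr powr_minus_divide flip: powr_realpow' powr_numeral)
  have "1 = (a - b) * (a ^ 2 + a * b + b ^ 2)"
    using a3 b3 by (simp add: algebra_simps power2_eq_square power3_eq_cube)
  also have "\<dots> \<le> (a - b) * (a ^ 2 + a * a + a ^ 2)"
    using ab by (intro mult_left_mono add_mono power_mono) auto
  also have "\<dots> = 3 * (a - b) * a ^ 2" by (simp add: power2_eq_square)
  finally have "1 / a ^ 2 \<le> 3 * (a - b)"
    using ab by (subst pos_divide_le_eq) auto
  then have "(\<Sum>i<n. (real i + 1) powr (- 2 / 3)) + (real n + 1) powr (- 2 / 3) \<le> 3 * b + 3 * (a - b)"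
    unfolding a2 b_def by (rule add_mono[OF Suc])
  also have "\<dots> = 3 * a" by simp
  finally show ?case unfolding sum.lessThan_Suc a_def by (simp add: add.commute)
qed simp

text \<open>The logarithmic squared price of the switches is absorbed by the cube root of the sample size,
  which is at least half of \<open>2 ^ m\<close> for a sequence of length \<open>m\<close>.\<close>

lemma square_le_two_power: "real m ^ 2 \<le> 2 * 2 ^ m"
proof (induction m rule: less_induct)
  case (less m)
  show ?case
  proof (cases "m \<le> 3")
    case True
    then have "m \<in> {0, 1, 2, 3}" by auto
    then show ?thesis by auto
  next
    case False
    then obtain l where l: "m = Suc l" "3 \<le> l" by (cases m) auto
    have "3 * real l \<le> real l * real l" using l by (intro mult_right_mono) auto
    then have "2 * real l + 1 \<le> real l * real l" using l by linarith
    then have "real m ^ 2 \<le> 2 * real l ^ 2" using l by (simp add: power2_eq_square algebra_simps)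
    also have "\<dots> \<le> 2 * (2 * 2 ^ l)" using less[of l] l by simp
    finally show ?thesis by (simp add: l)
  qed
qed

text \<open>With \<open>2 ^ j\<close> within a factor two of the cube root of \<open>n + 1\<close>, estimation and approximation error
  are both of order \<open>(n + 1) powr (- 2 / 3)\<close>.\<close>

lemma histogram_step_bound:
  fixes n j :: nat and A :: real
  assumes j: "8 ^ j \<le> n + 1" "n + 1 \<le> 8 ^ Suc j" and A: "0 \<le> A"
  shows "(real n + real (2 ^ j)) / (real n + 1) * (1 + A / real (2 ^ j) ^ 2) - 1 \<le> (1 + 8 * A) * (real n + 1) powr (- 2 / 3)"
proof -
  define N where "N = real n + 1"
  define k :: real where "k = 2 ^ j"
  define b where "b = N powr (1 / 3)"
  have N: "1 \<le> N" by (simp add: N_def)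
  have b: "0 < b" using N by (simp add: b_def)
  have b3: "b ^ 3 = N" using N by (simp add: b_def powr_powr flip: powr_realpow' powr_numeral)
  have b2: "N powr (- 2 / 3) = 1 / b ^ 2"
    using N by (simp add: b_def powr_powr powr_minus_divide flip: powr_realpow' powr_numeral)
  have "real (8 ^ j) \<le> real (n + 1)" "real (n + 1) \<le> real (8 ^ Suc j)"
    using j by (simp_all only: of_nat_le_iff)
  moreover have "(8::real) ^ j = k ^ 3" "(8::real) ^ Suc j = (2 * k) ^ 3"
    by (simp_all add: k_def power_mult_distrib flip: power_mult) (simp_all add: mult.commute[of j] power_mult)
  ultimately have "k ^ 3 \<le> b ^ 3" "b ^ 3 \<le> (2 * k) ^ 3"
    by (simp_all add: b3 N_def)
  then have kb: "k \<le> b" "b \<le> 2 * k"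
    using b by (auto simp: k_def intro: power_le_imp_le_base[of _ 2] simp: numeral_3_eq_3 dest: power_le_imp_le_base)
  have k1: "1 \<le> k" by (simp add: k_def)
  have "(real n + k) / N = 1 + (k - 1) / N" using N by (simp add: N_def field_simps)
  have inv: "1 / k ^ 2 \<le> 4 / b ^ 2"
  proof -
    have "b ^ 2 \<le> 4 * k ^ 2" using kb b power_mono[of b "2 * k" 2] by (simp add: power_mult_distrib)
    then show ?thesis using b k1 by (simp add: field_simps)
  qed
  have frac: "(k - 1) / N \<le> 1 / b ^ 2"
  proof -
    have "(k - 1) / N \<le> b / N" using kb N by (intro divide_right_mono) auto
    also have "b / N = 1 / b ^ 2" using b by (simp add: b3[symmetric] power2_eq_square power3_eq_cube)
    finally show ?thesis .
  qed
  have frac1: "(k - 1) / N \<le> 1"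
  proof -
    have "k \<le> k ^ 3" using k1 by (simp add: self_le_power)
    also have "\<dots> \<le> N" using \<open>k ^ 3 \<le> b ^ 3\<close> b3 by simp
    finally show ?thesis using N by simp
  qed
  have "(real n + k) / N * (1 + A / k ^ 2) - 1 = (k - 1) / N + (1 + (k - 1) / N) * (A / k ^ 2)"
    unfolding \<open>(real n + k) / N = 1 + (k - 1) / N\<close> by (simp add: algebra_simps)
  also have "\<dots> \<le> 1 / b ^ 2 + 2 * (A * (4 / b ^ 2))"
    using frac frac1 A inv mult_left_mono[OF inv A] by (intro add_mono mult_mono) auto
  also have "\<dots> = (1 + 8 * A) * (1 / b ^ 2)" by (simp add: algebra_simps add_divide_distrib)
  finally show ?thesis unfolding b2[symmetric] N_def k_def by simp
qed

context smooth_density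
begin

lemma sum_redundancy_doubling_le:
  assumes n: "n \<le> 8 ^ m" and m: "m \<ge> 1"
  shows "(\<Sum>i<n. redundancy (switch_strategy histogram (doubling m)) i)
    \<le> 3 * ((1 + 8 * (c2\<^sup>2 / c0)) / ln 2) * real n powr (1 / 3)"
proof -
  let ?q = "switch_strategy histogram (doubling m)"
  have "redundancy ?q i \<le> (1 + 8 * (c2\<^sup>2 / c0)) / ln 2 * (real i + 1) powr (- 2 / 3)" if i: "i < n" for i
  proof -
    from i n have "i < 8 ^ m" by simp
    then obtain j where j: "snd (doubling m ! active_index (doubling m) i) = 2 ^ j"
        "8 ^ j \<le> i + 1" "i + 1 \<le> 8 ^ Suc j"
      using m by (rule doubling_active)
    have "redundancy ?q i = redundancy (histogram (2 ^ j)) i"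
      by (simp add: redundancy_def switch_strategy_def j(1))
    also have "\<dots> \<le> ((real i + real (2 ^ j)) / (real i + 1) * (1 + c2\<^sup>2 / (c0 * real (2 ^ j) ^ 2)) - 1) / ln 2"
      by (rule redundancy_histogram_le) simp
    also have "\<dots> = ((real i + real (2 ^ j)) / (real i + 1) * (1 + c2\<^sup>2 / c0 / real (2 ^ j) ^ 2) - 1) / ln 2"
      by simp
    also have "\<dots> \<le> ((1 + 8 * (c2\<^sup>2 / c0)) * (real i + 1) powr (- 2 / 3)) / ln 2"
      using c0_pos by (intro divide_right_mono histogram_step_bound j) auto
    finally show ?thesis by simp
  qed
  moreover define K where "K = (1 + 8 * (c2\<^sup>2 / c0)) / ln 2"
  ultimately have "(\<Sum>i<n. redundancy ?q i) \<le> (\<Sum>i<n. K * (real i + 1) powr (- 2 / 3))"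
    by (intro sum_mono) simp
  also have "\<dots> = K * (\<Sum>i<n. (real i + 1) powr (- 2 / 3))"
    by (simp add: sum_distrib_left)
  also have "\<dots> \<le> K * (3 * real n powr (1 / 3))"
    using c0_pos by (intro mult_left_mono sum_powr_le) (auto simp: K_def)
  also have "\<dots> = 3 * K * real n powr (1 / 3)" by simp
  finally show ?thesis unfolding K_def by simp
qed

end

text \<open>A sequence whose coordinates are independent with a common density has the product law.\<close>

lemma smooth_iid_cases:
  assumes Q: "Q \<in> smooth_iid c0 c1 c2" and c0: "0 < c0"
  obtains f f' where "smooth_density f c0 c1 f' c2" "Q = bounded_density.P f"
proof -
  from Q obtain f f' where prob: "prob_space Q" and sets: "sets Q = sets (seq_space UNIV)"
    and indep: "prob_space.indep_vars Q (\<lambda>_. unit_lborel) (\<lambda>i \<omega>. \<omega> i) UNIV"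
    and dist: "\<And>i. distributed Q unit_lborel (\<lambda>\<omega>. \<omega> i) (\<lambda>x. ennreal (f x))"
    and f: "\<And>x. x \<in> {0..1} \<Longrightarrow> c0 \<le> f x \<and> f x \<le> c1 \<and>
           (f has_real_derivative f' x) (at x within {0..1}) \<and> \<bar>f' x\<bar> \<le> c2"
    unfolding smooth_iid_def by blast
  interpret Q: prob_space Q by (rule prob)
  have "(\<lambda>x. enn2real (ennreal (f x))) \<in> borel_measurable unit_lborel"
    using distributed_borel_measurable[OF dist[of 0]] by measurable
  also have "?this \<longleftrightarrow> f \<in> borel_measurable unit_lborel"
    using f c0 by (intro measurable_cong) (force simp: less_imp_le dest: less_le_trans)
  finally have fm: "f \<in> borel_measurable unit_lborel" .
  have D: "distr Q unit_lborel (\<lambda>\<omega>. \<omega> i) = density unit_lborel (\<lambda>x. ennreal (f x))" for i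
    using dist[of i] by (simp add: distributed_def)
  have rv: "(\<lambda>\<omega>. \<omega> i) \<in> Q \<rightarrow>\<^sub>M unit_lborel" for i
    using dist[of i] by (simp add: distributed_def)
  have "prob_space (density unit_lborel (\<lambda>x. ennreal (f x)))"
    using Q.prob_space_distr[OF rv[of 0]] unfolding D .
  from prob_space.emeasure_space_1[OF this]
  have "emeasure (density unit_lborel (\<lambda>x. ennreal (f x))) {0..1} = 1" by simp
  then have fi: "(\<integral>\<^sup>+x. ennreal (f x) \<partial>unit_lborel) = 1"
  proof (subst (asm) emeasure_density)
    assume "(\<integral>\<^sup>+x. ennreal (f x) * indicator {0..1} x \<partial>unit_lborel) = 1"
    also have "(\<integral>\<^sup>+x. ennreal (f x) * indicator {0..1} x \<partial>unit_lborel) = (\<integral>\<^sup>+x. ennreal (f x) \<partial>unit_lborel)"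
      by (intro nn_integral_cong) auto
    finally show ?thesis .
  qed (use fm in \<open>auto intro: sets_unit_lborel\<close>)
  have sd: "smooth_density f c0 c1 f' c2"
    using f c0 fm fi by unfold_locales auto
  interpret smooth_density f c0 c1 f' c2 by (rule sd)
  have "distr Q (\<Pi>\<^sub>M i\<in>UNIV. unit_lborel) (\<lambda>\<omega>. \<lambda>i\<in>UNIV. \<omega> i) = (\<Pi>\<^sub>M i\<in>UNIV. distr Q unit_lborel (\<lambda>\<omega>. \<omega> i))"
    using indep rv by (subst (asm) Q.indep_vars_iff_distr_eq_PiM) auto
  then have "distr Q (\<Pi>\<^sub>M i\<in>UNIV. unit_lborel) (\<lambda>\<omega>. \<omega>) = P"
    by (simp add: D P_def D_def restrict_UNIV)
  moreover have "distr Q (\<Pi>\<^sub>M i\<in>UNIV. unit_lborel) (\<lambda>\<omega>. \<omega>) = Q"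
    using sets unfolding seq_space_def by (intro distr_id2) simp
  ultimately show ?thesis using that[OF sd] by simp
qed

text \<open>The last switch is taken at the largest power of eight that does not exceed \<open>n\<close>. The constants do not
  depend on the density \<open>f\<close>, which makes the bound uniform over the model.\<close>

lemma (in smooth_density) sum_risk_switch_le:
  fixes \<pi>M \<pi>K \<pi>T :: "nat pmf"
  assumes pmfs: "set_pmf \<pi>M = {1..}" "set_pmf \<pi>K = {1..}" "set_pmf \<pi>T = {1..}"
    and B: "B \<ge> 0" "\<And>m. m \<ge> 1 \<Longrightarrow> - log 2 (product_prior \<pi>M \<pi>K \<pi>T (doubling m)) \<le> B * real m ^ 2"
    and n: "n \<ge> 1"
  shows "(\<Sum>i=1..n. risk i P (switch_distribution histogram (product_prior \<pi>M \<pi>K \<pi>T)))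
    \<le> ennreal ((4 * B + 3 * ((1 + 8 * (c2\<^sup>2 / c0)) / ln 2)) * real n powr (1 / 3))"
proof -
  let ?pi = "product_prior \<pi>M \<pi>K \<pi>T"
  let ?sw = "switch_distribution histogram ?pi"
  interpret expert_mixture histogram ?pi
    by (rule expert_mixture_product_prior[OF pmfs])
  obtain j where j: "8 ^ j \<le> n" "n < 8 ^ Suc j"
    using ex_power_ivl1[of 8 n] n by auto
  define s where "s = doubling (Suc j)"
  have s: "s \<in> switch_params" unfolding s_def by (rule doubling_in_switch_params) simp
  have pi_pos: "0 < ?pi s" unfolding s_def by (rule product_prior_doubling_pos[OF pmfs]) simp
  have two: "2 ^ j \<le> real n powr (1 / 3)"
  proof -
    have "(2::real) ^ j = ((2 ^ j) ^ 3) powr (1 / 3)"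
      by (simp add: powr_powr flip: powr_numeral)
    also have "((2::real) ^ j) ^ 3 = (2 ^ 3) ^ j" by (simp only: power_mult[symmetric] mult.commute)
    also have "(2 ^ 3) ^ j = (8::real) ^ j" by simp
    also have "\<dots> powr (1 / 3) \<le> real n powr (1 / 3)"
    proof (rule powr_mono2)
      have "real (8 ^ j) \<le> real n" using j(1) by (simp only: of_nat_le_iff)
      then show "(8::real) ^ j \<le> real n" by simp
    qed auto
    finally show ?thesis .
  qed
  have "- log 2 (?pi s) \<le> B * real (Suc j) ^ 2" unfolding s_def by (rule B(2)) simp
  also have "\<dots> \<le> B * (4 * real n powr (1 / 3))"
    using square_le_two_power[of "Suc j"] two by (intro mult_left_mono B(1)) simp
  finally have pr: "- log 2 (?pi s) \<le> 4 * B * real n powr (1 / 3)" by simp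
  have Z: "0 < switch_density histogram ?pi []" "switch_density histogram ?pi [] \<le> 1"
    by (rule switch_density_pos) (simp add: switch_density_def product_prior_summable(2)[OF pmfs(3)])
  have dom: "?pi s * joint_density (qs s) xs \<le> joint_density ?sw xs" for xs
  proof -
    have "?pi s * joint_density (qs s) xs \<le> switch_density histogram ?pi xs"
      using switch_density_ge[OF s, of xs] by (simp add: mult.commute)
    also have "\<dots> \<le> switch_density histogram ?pi xs / switch_density histogram ?pi []"
      using Z switch_density_pos[of xs] by (simp add: pos_le_divide_eq)
    also have "\<dots> = joint_density ?sw xs" by (rule joint_density_switch_distribution[symmetric])
    finally show ?thesis .
  qed
  have "(\<Sum>i<n. redundancy ?sw i) \<le> - log 2 (?pi s) + (\<Sum>i<n. redundancy (qs s) i)"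
    by (rule sum_redundancy_le[OF admissible_switch_distribution admissible_qs[OF s] pi_pos dom])
  also have "\<dots> \<le> 4 * B * real n powr (1 / 3) + 3 * ((1 + 8 * (c2\<^sup>2 / c0)) / ln 2) * real n powr (1 / 3)"
    using j unfolding s_def by (intro add_mono pr[unfolded s_def] sum_redundancy_doubling_le) auto
  also have "\<dots> = (4 * B + 3 * ((1 + 8 * (c2\<^sup>2 / c0)) / ln 2)) * real n powr (1 / 3)"
    by (rule distrib_right[symmetric])
  finally show ?thesis
    unfolding sum_risk_eq[OF admissible_switch_distribution] by (rule ennreal_leI)
qed

theorem theorem4:
  fixes c0 c1 c2 :: real and \<pi>M \<pi>K \<pi>T :: "nat pmf"
  assumes "0 < c0" and "c0 < 1" and "1 < c1"
    and "set_pmf \<pi>M = {1..}" and "set_pmf \<pi>K = {1..}" and "set_pmf \<pi>T = {1..}"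
    and "(\<lambda>m. - log 2 (pmf \<pi>M m)) \<in> O(\<lambda>m. real m)"
    and "(\<lambda>k. - log 2 (pmf \<pi>K k)) \<in> O(\<lambda>k. log 2 (real k))"
    and "(\<lambda>t. - log 2 (pmf \<pi>T t)) \<in> O(\<lambda>t. log 2 (real t))"
  shows "\<exists>C>0. \<exists>n0. \<forall>n\<ge>n0.
    (SUP P\<in>smooth_iid c0 c1 c2. \<Sum>i=1..n.
       risk i P (switch_distribution histogram (product_prior \<pi>M \<pi>K \<pi>T)))
    \<le> ennreal (C * real n powr (1/3))"
proof -
  obtain B where B: "B \<ge> 0"
    "\<And>m. m \<ge> 1 \<Longrightarrow> - log 2 (product_prior \<pi>M \<pi>K \<pi>T (doubling m)) \<le> B * real m ^ 2"
    using neg_log_prior_doubling[OF assms(4-9)] by blast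
  define C where "C = 4 * B + 3 * ((1 + 8 * (c2\<^sup>2 / c0)) / ln 2)"
  have "0 < C"
    unfolding C_def using B(1) assms(1)
    by (intro add_nonneg_pos mult_pos_pos divide_pos_pos add_pos_nonneg mult_nonneg_nonneg divide_nonneg_pos) auto
  moreover have "(SUP P\<in>smooth_iid c0 c1 c2. \<Sum>i=1..n.
       risk i P (switch_distribution histogram (product_prior \<pi>M \<pi>K \<pi>T))) \<le> ennreal (C * real n powr (1/3))"
    if n: "n \<ge> 1" for n
  proof (rule SUP_least)
    fix Q assume "Q \<in> smooth_iid c0 c1 c2"
    then obtain f f' where sd: "smooth_density f c0 c1 f' c2" and Q: "Q = bounded_density.P f"
      using assms(1) by (rule smooth_iid_cases)
    show "(\<Sum>i=1..n. risk i Q (switch_distribution histogram (product_prior \<pi>M \<pi>K \<pi>T)))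
        \<le> ennreal (C * real n powr (1/3))"
      unfolding Q C_def by (rule smooth_density.sum_risk_switch_le[OF sd assms(4-6) B n])
  qed
  ultimately show ?thesis by blast
qed

end
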